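(* Suppose $N$ is the exterior of a two-bridge knot and $\langle\mu,\beta\,|\,\omega\beta=\mu\omega\rangle$ is the standard presentation of $\pi_1(N)$. If $\mathsf{X}\subseteq\mathsf{X}(N)$ is an irreducible algebraic component defined over $\mathbb{Q}$, then there are an integer $n\ge 1$ and polynomials $p_0,\dots,p_{n-1}\in\mathbb{Z}[x]$ such that, with respect to the coordinates $(x,y)=(I_\mu,I_{\mu\beta})$, $\mathsf{X}$ is the zero set in $\mathbb{C}^2$ of a polynomial, irreducible in $\mathbb{C}[x,y]$, of the form $$y^n-\sum_{j=0}^{n-1}p_j(x)\,y^j .$$ Moreover, the set $\{I_{\mu\beta}^j\}_{j=0}^{n-1}$ is a free basis for $\mathbb{C}[\mathsf{X}]$ as a $\mathbb{C}[I_\mu]$-module, for $T_{\mathbb{Q}}(\mathsf{X})$ as a $\mathbb{Q}[I_\mu]$-module, and for $T(\mathsf{X})$ as a $\mathbb{Z}[I_\mu]$-module.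
   Context: The standard presentation of the group of a (non-trivial) two-bridge knot with normal form $(p,q)$, $p$ and $q$ odd and coprime, $0<q<p$, is $\langle\mu,\beta\,|\,\omega\beta=\mu\omega\rangle$, where $\mu,\beta$ are meridians and $\omega=\beta^{e_1}\mu^{e_2}\cdots\beta^{e_{p-2}}\mu^{e_{p-1}}$ with $e_i=(-1)^{\lfloor iq/p\rfloor}$. $\mathsf{X}(N)$ is the affine algebraic set of characters $\chi_\rho=\mathrm{Tr}\circ\rho$ of representations $\rho\colon\pi_1(N)\to\mathrm{SL}_2(\mathbb{C})$. For an algebraic subset $\mathsf{X}\subseteq\mathsf{X}(N)$ and $\gamma\in\pi_1(N)$, $I_\gamma\in\mathbb{C}[\mathsf{X}]$ is $I_\gamma(\chi)=\chi(\gamma)$. The functions $I_\mu$ and $I_{\mu\beta}$ embed $\mathsf{X}(N)$ in $\mathbb{C}^2$ (note $I_\beta=I_\mu$), as an algebraic set cut out by polynomials with rational coefficients, and "defined over $\mathbb{Q}$" refers to these coordinates. The trace ring $T(\mathsf{X})$ is the subring (with 1) of $\mathbb{C}[\mathsf{X}]$ generated by all $I_\gamma$, and $T_{\mathbb{Q}}(\mathsf{X})$ is the smallest $\mathbb{Q}$-subalgebra of $\mathbb{C}[\mathsf{X}]$ containing $T(\mathsf{X})$. $\mathbb{C}[I_\mu],\mathbb{Q}[I_\mu],\mathbb{Z}[I_\mu]$ denote the subrings generated by $I_\mu$ over the indicated ring. *)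

theory Defs
  imports
    "HOL-Algebra.Generated_Rings"
    "HOL-Algebra.Module"
    "HOL-Computational_Algebra.Polynomial"
    "HOL-Analysis.Analysis"
begin

section \<open>Group presentations\<close>

text \<open>
  A letter \<open>(x, True)\<close> stands for the generator \<open>x\<close>, and \<open>(x, False)\<close> for its inverse.
\<close>

type_synonym 'x word = "('x \<times> bool) list"

text \<open>
  For a set \<open>R\<close> of pairs of words, each read as a relation \<open>u = v\<close>, \<open>pres_eq R\<close> is equality in the
  abstract group presented by the generators of type \<open>'x\<close> and the relations \<open>R\<close>.
\<close>

inductive pres_eq :: "('x word \<times> 'x word) set \<Rightarrow> 'x word \<Rightarrow> 'x word \<Rightarrow> bool"
  for R where
  refl: "pres_eq R u u"
| sym: "pres_eq R u v \<Longrightarrow> pres_eq R v u"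
| trans: "pres_eq R u v \<Longrightarrow> pres_eq R v w \<Longrightarrow> pres_eq R u w"
| cancel: "pres_eq R (a @ [(x, s), (x, \<not> s)] @ b) (a @ b)"
| relation: "(u, v) \<in> R \<Longrightarrow> pres_eq R (a @ u @ b) (a @ v @ b)"

definition word_eval :: "('g, 'm) monoid_scheme \<Rightarrow> ('x \<Rightarrow> 'g) \<Rightarrow> 'x word \<Rightarrow> 'g" where
  "word_eval G \<gamma> w =
     foldr (\<lambda>(x, s) g. (if s then \<gamma> x else inv\<^bsub>G\<^esub> (\<gamma> x)) \<otimes>\<^bsub>G\<^esub> g) w \<one>\<^bsub>G\<^esub>"

text \<open>
  \<open>G\<close> is presented by the generators \<open>\<gamma> x\<close> and the relations \<open>R\<close>: evaluation of words induces
  an isomorphism from the abstractly presented group onto \<open>G\<close>.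
\<close>

definition is_presentation ::
    "('g, 'm) monoid_scheme \<Rightarrow> ('x \<Rightarrow> 'g) \<Rightarrow> ('x word \<times> 'x word) set \<Rightarrow> bool" where
  "is_presentation G \<gamma> R \<longleftrightarrow>
     group G \<and> range \<gamma> \<subseteq> carrier G \<and>
     (\<forall>g\<in>carrier G. \<exists>w. word_eval G \<gamma> w = g) \<and>
     (\<forall>u v. word_eval G \<gamma> u = word_eval G \<gamma> v \<longleftrightarrow> pres_eq R u v)"


section \<open>Two-bridge knot groups\<close>

datatype two_bridge_gen = Mu | Beta

text \<open>
  The word \<open>\<beta>\<^bsup>e 1\<^esup> \<mu>\<^bsup>e 2\<^esup> \<cdots> \<beta>\<^bsup>e (p - 2)\<^esup> \<mu>\<^bsup>e (p - 1)\<^esup>\<close> with \<open>e i = (-1) ^ \<lfloor>i q / p\<rfloor>\<close>; the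
  exponent \<open>e i\<close> is \<open>1\<close> exactly if the integer quotient \<open>i * q div p\<close> is even.
\<close>

definition two_bridge_word :: "nat \<Rightarrow> nat \<Rightarrow> two_bridge_gen word" where
  "two_bridge_word p q =
     map (\<lambda>i. (if odd i then Beta else Mu, even (i * q div p))) [1..<p]"

definition two_bridge_relation ::
    "nat \<Rightarrow> nat \<Rightarrow> two_bridge_gen word \<times> two_bridge_gen word" where
  "two_bridge_relation p q =
     (two_bridge_word p q @ [(Beta, True)], [(Mu, True)] @ two_bridge_word p q)"

text \<open>
  \<open>G\<close> is the group of the two-bridge knot with normal form \<open>(p, q)\<close>, and
  \<open>\<langle>\<mu>, \<beta> | \<omega> \<beta> = \<mu> \<omega>\<rangle>\<close> is its standard presentation.
\<close>

definition two_bridge_presentation ::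
    "('g, 'm) monoid_scheme \<Rightarrow> 'g \<Rightarrow> 'g \<Rightarrow> nat \<Rightarrow> nat \<Rightarrow> bool" where
  "two_bridge_presentation G \<mu> \<beta> p q \<longleftrightarrow>
     odd p \<and> odd q \<and> coprime p q \<and> 0 < q \<and> q < p \<and>
     is_presentation G (\<lambda>x. case x of Mu \<Rightarrow> \<mu> | Beta \<Rightarrow> \<beta>) {two_bridge_relation p q}"


section \<open>Characters\<close>

definition SL2 :: "(complex^2^2) monoid" where
  "SL2 = \<lparr>carrier = {A. det A = 1}, monoid.mult = (**), one = mat 1\<rparr>"

definition character ::
    "('g, 'm) monoid_scheme \<Rightarrow> ('g \<Rightarrow> complex^2^2) \<Rightarrow> 'g \<Rightarrow> complex" where
  "character G \<rho> = (\<lambda>g\<in>carrier G. trace (\<rho> g))"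

definition char_variety :: "('g, 'm) monoid_scheme \<Rightarrow> ('g \<Rightarrow> complex) set" where
  "char_variety G = character G ` hom G SL2"

text \<open>
  The coordinates \<open>(x, y) = (I\<^sub>\<mu>, I\<^sub>\<mu>\<^sub>\<beta>)\<close>. For a two-bridge knot group they embed the set of characters
  in the plane, and its structure as an algebraic set is the one of its image.
\<close>

definition coords ::
    "('g, 'm) monoid_scheme \<Rightarrow> 'g \<Rightarrow> 'g \<Rightarrow> ('g \<Rightarrow> complex) \<Rightarrow> complex \<times> complex" where
  "coords G \<mu> \<beta> \<xi> = (\<xi> \<mu>, \<xi> (\<mu> \<otimes>\<^bsub>G\<^esub> \<beta>))"


section \<open>Algebraic subsets of the plane\<close>

text \<open>
  Polynomials in \<open>x\<close> and \<open>y\<close> are represented as polynomials in \<open>y\<close> whose coefficients are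
  polynomials in \<open>x\<close>.
\<close>

definition poly2 :: "complex poly poly \<Rightarrow> complex \<times> complex \<Rightarrow> complex" where
  "poly2 P z = poly (poly P [:snd z:]) (fst z)"

definition zero_locus :: "complex poly poly set \<Rightarrow> (complex \<times> complex) set" where
  "zero_locus S = {z. \<forall>P\<in>S. poly2 P z = 0}"

definition algebraic_set :: "(complex \<times> complex) set \<Rightarrow> bool" where
  "algebraic_set V \<longleftrightarrow> (\<exists>S. V = zero_locus S)"

definition defined_over_Q :: "(complex \<times> complex) set \<Rightarrow> bool" where
  "defined_over_Q V \<longleftrightarrow>
     (\<exists>S :: rat poly poly set. V = zero_locus (map_poly (map_poly of_rat) ` S))"

definition irreducible_algebraic_set :: "(complex \<times> complex) set \<Rightarrow> bool" where
  "irreducible_algebraic_set V \<longleftrightarrow>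
     algebraic_set V \<and> V \<noteq> {} \<and>
     (\<forall>A B. algebraic_set A \<and> algebraic_set B \<and> V = A \<union> B \<longrightarrow> V = A \<or> V = B)"

definition irreducible_component ::
    "(complex \<times> complex) set \<Rightarrow> (complex \<times> complex) set \<Rightarrow> bool" where
  "irreducible_component V W \<longleftrightarrow>
     irreducible_algebraic_set V \<and> V \<subseteq> W \<and>
     (\<forall>V'. irreducible_algebraic_set V' \<and> V \<subseteq> V' \<and> V' \<subseteq> W \<longrightarrow> V' = V)"


section \<open>Coordinate ring and trace rings\<close>

text \<open>
  Elements of \<open>\<complex>[X]\<close> are the functions on \<open>X\<close> that are polynomial in the coordinates, with value
  \<open>undefined\<close> outside \<open>X\<close> so that equality means equality on \<open>X\<close>.
\<close>

definition coord_ring ::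
    "('g, 'm) monoid_scheme \<Rightarrow> 'g \<Rightarrow> 'g \<Rightarrow> ('g \<Rightarrow> complex) set \<Rightarrow> (('g \<Rightarrow> complex) \<Rightarrow> complex) ring"
  where
  "coord_ring G \<mu> \<beta> X =
     \<lparr>carrier = range (\<lambda>P. \<lambda>\<xi>\<in>X. poly2 P (coords G \<mu> \<beta> \<xi>)),
      monoid.mult = (\<lambda>f g. \<lambda>\<xi>\<in>X. f \<xi> * g \<xi>), one = (\<lambda>\<xi>\<in>X. 1),
      zero = (\<lambda>\<xi>\<in>X. 0), add = (\<lambda>f g. \<lambda>\<xi>\<in>X. f \<xi> + g \<xi>)\<rparr>"

definition const_fun :: "('g \<Rightarrow> complex) set \<Rightarrow> complex \<Rightarrow> ('g \<Rightarrow> complex) \<Rightarrow> complex" where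
  "const_fun X c = (\<lambda>\<xi>\<in>X. c)"

definition I_fun :: "('g \<Rightarrow> complex) set \<Rightarrow> 'g \<Rightarrow> ('g \<Rightarrow> complex) \<Rightarrow> complex" where
  "I_fun X g = (\<lambda>\<xi>\<in>X. \<xi> g)"

definition trace_ring ::
    "('g, 'm) monoid_scheme \<Rightarrow> 'g \<Rightarrow> 'g \<Rightarrow> ('g \<Rightarrow> complex) set \<Rightarrow> (('g \<Rightarrow> complex) \<Rightarrow> complex) set"
  where
  "trace_ring G \<mu> \<beta> X = generate_ring (coord_ring G \<mu> \<beta> X) (I_fun X ` carrier G)"

text \<open>A subring is a \<open>\<rat>\<close>-subalgebra iff it contains the rational constants.\<close>

definition trace_algebra_Q ::
    "('g, 'm) monoid_scheme \<Rightarrow> 'g \<Rightarrow> 'g \<Rightarrow> ('g \<Rightarrow> complex) set \<Rightarrow> (('g \<Rightarrow> complex) \<Rightarrow> complex) set"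
  where
  "trace_algebra_Q G \<mu> \<beta> X =
     \<Inter> {S. subring S (coord_ring G \<mu> \<beta> X) \<and> const_fun X ` \<rat> \<subseteq> S \<and> trace_ring G \<mu> \<beta> X \<subseteq> S}"

text \<open>The subring \<open>K[I\<^sub>\<mu>]\<close> of \<open>\<complex>[X]\<close>, for a subring \<open>K\<close> of \<open>\<complex>\<close>.\<close>

definition I_mu_ring ::
    "('g, 'm) monoid_scheme \<Rightarrow> 'g \<Rightarrow> 'g \<Rightarrow> ('g \<Rightarrow> complex) set \<Rightarrow> complex set \<Rightarrow>
     (('g \<Rightarrow> complex) \<Rightarrow> complex) set" where
  "I_mu_ring G \<mu> \<beta> X K =
     generate_ring (coord_ring G \<mu> \<beta> X) (const_fun X ` K \<union> {I_fun X \<mu>})"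


section \<open>Free bases\<close>

text \<open>
  A subset \<open>M\<close> of a ring \<open>A\<close> as a module whose scalars, elements of \<open>A\<close>, act by multiplication in \<open>A\<close>.
\<close>

definition mult_module :: "('a, 'm) ring_scheme \<Rightarrow> 'a set \<Rightarrow> ('a, 'a) module" where
  "mult_module A M =
     \<lparr>carrier = M, monoid.mult = (\<otimes>\<^bsub>A\<^esub>), one = \<one>\<^bsub>A\<^esub>, zero = \<zero>\<^bsub>A\<^esub>,
      add = (\<oplus>\<^bsub>A\<^esub>), module.smult = (\<otimes>\<^bsub>A\<^esub>)\<rparr>"

definition free_basis ::
    "('r, 'k) ring_scheme \<Rightarrow> ('r, 'a, 'l) module_scheme \<Rightarrow> 'i set \<Rightarrow> ('i \<Rightarrow> 'a) \<Rightarrow> bool" where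
  "free_basis R M I b \<longleftrightarrow>
     Module.module R M \<and> finite I \<and> b ` I \<subseteq> carrier M \<and>
     (\<forall>m\<in>carrier M. \<exists>!c. c \<in> I \<rightarrow>\<^sub>E carrier R \<and> m = (\<Oplus>\<^bsub>M\<^esub>i\<in>I. c i \<odot>\<^bsub>M\<^esub> b i))"

definition free_basis_in ::
    "('a, 'm) ring_scheme \<Rightarrow> 'a set \<Rightarrow> 'a set \<Rightarrow> 'i set \<Rightarrow> ('i \<Rightarrow> 'a) \<Rightarrow> bool" where
  "free_basis_in A R M I b \<longleftrightarrow> free_basis (A\<lparr>carrier := R\<rparr>) (mult_module A M) I b"

end

theory Submission
  imports Defs "HOL-Computational_Algebra.Polynomial_Factorial"
    "HOL-Computational_Algebra.Fundamental_Theorem_Algebra" "HOL-Computational_Algebra.Field_as_Ring"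
begin

text \<open>
  Let \<open>A\<close>, \<open>B\<close> be the images of \<open>\<mu>\<close>, \<open>\<beta>\<close> and \<open>W\<close> that of \<open>\<omega>\<close>, let \<open>x = tr A = tr B\<close>, \<open>y = tr (A B)\<close>, and put
  \<open>J = A + B - x\<close>, so that \<open>J A = B J\<close> and \<open>det J = 2 - y\<close>. Write \<open>W J = a + b A + c B + d B A\<close> with
  \<open>a, b, c, d \<in> \<int>[x, y]\<close>. Reversing \<open>\<omega>\<close> exchanges \<open>\<mu>\<close> and \<open>\<beta>\<close>, and this symmetry forces \<open>d = 0\<close>; hence
  for non-commuting \<open>A\<close>, \<open>B\<close> and invertible \<open>J\<close> the relation \<open>W B = A W\<close> amounts to \<open>c = 0\<close>. A weight
  argument shows that \<open>\<plusminus>c\<close> is monic in \<open>y\<close>, so the set of characters is the curve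
  \<open>(y - x\<^sup>2 + 2) c = 0\<close>, given by a polynomial over \<open>\<int>[x]\<close> that is monic in \<open>y\<close>.
  
  A component \<open>V\<close> of the curve is the zero set of a monic prime factor \<open>F\<close> over \<open>\<complex>\<close>, so it surjects onto
  the \<open>x\<close>-axis. If \<open>f\<close> is a monic prime factor over \<open>\<int>\<close> vanishing on \<open>V\<close>, elimination of \<open>y\<close> shows that
  \<open>f\<close> divides every integral polynomial vanishing on \<open>V\<close>; as \<open>V\<close> is defined over \<open>\<rat>\<close>, \<open>f\<close> has zero set \<open>V\<close>.
  Over almost every \<open>x\<close> it has \<open>deg f\<close> distinct roots, hence \<open>f = F\<close>. The free bases then come from
  division with remainder by the monic polynomial \<open>f\<close>, and the trace of every word is in \<open>\<int>[x, y]\<close>.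
\<close>

section \<open>Components of a curve that is monic over the integers\<close>

lemma map_poly_hom_mult:
  fixes f :: "'a::comm_ring_1 \<Rightarrow> 'b::comm_ring_1"
  assumes "f 0 = 0" and "\<And>a b. f (a + b) = f a + f b" and "\<And>a b. f (a * b) = f a * f b"
  shows "map_poly f (p * q) = map_poly f p * map_poly f q"
proof (induction p)
  case 0
  show ?case by simp
next
  case (pCons a p)
  have add: "map_poly f (r + s) = map_poly f r + map_poly f s" for r s
    by (rule poly_eqI) (simp add: coeff_map_poly assms)
  have smult: "map_poly f (smult c r) = smult (f c) (map_poly f r)" for c r
    by (rule poly_eqI) (simp add: coeff_map_poly assms)
  show ?case
    by (simp add: add smult pCons.IH map_poly_pCons assms)
qed

definition complexify :: "int poly poly \<Rightarrow> complex poly poly" where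
  "complexify = map_poly (map_poly of_int)"

lemma coeff_complexify: "coeff (complexify P) i = map_poly of_int (coeff P i)"
  by (simp add: complexify_def coeff_map_poly)

lemma complexify_0 [simp]: "complexify 0 = 0"
  by (simp add: complexify_def)

lemma complexify_1 [simp]: "complexify 1 = 1"
  by (simp add: complexify_def)

lemma of_int_poly_add: "map_poly of_int (p + q) = map_poly of_int p + (map_poly of_int q :: complex poly)"
  by (rule poly_eqI) (simp add: coeff_map_poly)

lemma of_int_poly_mult: "map_poly of_int (p * q) = map_poly of_int p * (map_poly of_int q :: complex poly)"
  by (rule map_poly_hom_mult) simp_all

lemma complexify_add [simp]: "complexify (P + Q) = complexify P + complexify Q"
  by (rule poly_eqI) (simp add: coeff_complexify of_int_poly_add)

lemma complexify_uminus [simp]: "complexify (- P) = - complexify P"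
  by (intro poly_eqI) (simp add: coeff_complexify coeff_map_poly)

lemma complexify_diff [simp]: "complexify (P - Q) = complexify P - complexify Q"
  using complexify_add[of P "- Q"] by simp

lemma complexify_mult [simp]: "complexify (P * Q) = complexify P * complexify Q"
  unfolding complexify_def by (rule map_poly_hom_mult) (simp_all add: of_int_poly_add of_int_poly_mult)

lemma complexify_pCons [simp]: "complexify (pCons p P) = pCons (map_poly of_int p) (complexify P)"
  by (simp add: complexify_def map_poly_pCons)

lemma degree_complexify [simp]: "degree (complexify P) = degree P"
  unfolding complexify_def by (rule degree_map_poly) (auto simp: map_poly_eq_0_iff)

lemma complexify_eq_0_iff [simp]: "complexify P = 0 \<longleftrightarrow> P = 0"
  unfolding complexify_def by (subst map_poly_eq_0_iff) (auto simp: map_poly_eq_0_iff)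

lemma poly2_add [simp]: "poly2 (P + Q) z = poly2 P z + poly2 Q z"
  and poly2_diff [simp]: "poly2 (P - Q) z = poly2 P z - poly2 Q z"
  and poly2_uminus [simp]: "poly2 (- P) z = - poly2 P z"
  and poly2_mult [simp]: "poly2 (P * Q) z = poly2 P z * poly2 Q z"
  and poly2_0 [simp]: "poly2 0 z = 0"
  and poly2_1 [simp]: "poly2 1 z = 1"
  and poly2_pCons [simp]: "poly2 (pCons p P) z = poly p (fst z) + snd z * poly2 P z"
  by (simp_all add: poly2_def)

lemma poly2_eq_poly_slice: "poly2 P (x, y) = poly (map_poly (\<lambda>c. poly c x) P) y"
  by (induction P) (simp_all add: map_poly_pCons)

lemma map_poly_monic:
  fixes f :: "'a::comm_semiring_1 \<Rightarrow> 'b::comm_semiring_1"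
  assumes "lead_coeff P = 1" and "f 1 = 1" "f 0 = 0"
  shows "degree (map_poly f P) = degree P" "lead_coeff (map_poly f P) = 1"
proof -
  show "degree (map_poly f P) = degree P"
    using assms by (auto intro!: map_poly_degree_eq)
  then show "lead_coeff (map_poly f P) = 1"
    using assms by (simp add: coeff_map_poly)
qed

text \<open>Specializing \<open>x\<close> keeps the degree in \<open>y\<close> because the leading
  coefficient is 1, so the fundamental theorem of algebra applies on every vertical line.\<close>

lemma monic_root_on_line:
  fixes F :: "complex poly poly"
  assumes "lead_coeff F = 1" and "degree F > 0"
  obtains y where "poly2 F (x, y) = 0"
proof -
  have "degree (map_poly (\<lambda>c. poly c x) F) > 0"
    using assms by (simp add: map_poly_monic)
  then have "\<not> constant (poly (map_poly (\<lambda>c. poly c x) F))"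
    by (simp add: constant_degree)
  from fundamental_theorem_of_algebra[OF this] show ?thesis
    using that by (auto simp: poly2_eq_poly_slice)
qed

text \<open>Over the fraction field of the coefficients, \<open>f\<close> and \<open>s\<close> would
  be coprime and Bezout would apply. Fractions are avoided by taking a nonzero element
  \<open>d\<close> of least degree in the ideal generated by \<open>f\<close> and \<open>s\<close>
  and dividing by it with pseudo-division.\<close>

lemma prime_elem_elimination:
  fixes f s :: "'a::idom poly"
  assumes prime: "prime_elem f" and deg: "degree f > 0" and ndvd: "\<not> f dvd s"
  obtains u v r where "r \<noteq> 0" and "u * f + v * s = [:r:]"
proof -
  define I where "I = {u * f + v * s | u v. True}"
  have memI: "u * f + v * s \<in> I" for u v
    unfolding I_def by blast
  have lin: "a * g + b * h \<in> I" if "g \<in> I" "h \<in> I" for a b g h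
  proof -
    from that obtain u v u' v' where *: "g = u * f + v * s" "h = u' * f + v' * s"
      unfolding I_def by blast
    have "a * g + b * h = (a * u + b * u') * f + (a * v + b * v') * s"
      unfolding * by (simp add: algebra_simps)
    then show ?thesis using memI by simp
  qed
  have fI: "f \<in> I" and sI: "s \<in> I"
    using memI[of 1 0] memI[of 0 1] by simp_all
  have f0: "f \<noteq> 0" using deg by auto
  define d where "d = arg_min degree (\<lambda>g. g \<in> I \<and> g \<noteq> 0)"
  have d: "d \<in> I" "d \<noteq> 0"
    using arg_min_natI[of "\<lambda>g. g \<in> I \<and> g \<noteq> 0" f degree] fI f0 by (auto simp: d_def)
  have dmin: "degree d \<le> degree g" if "g \<in> I" "g \<noteq> 0" for g
    using arg_min_nat_le[of "\<lambda>g. g \<in> I \<and> g \<noteq> 0" g degree] that by (auto simp: d_def)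
  \<comment> \<open>The pseudo-remainder of \<open>g\<close> by \<open>d\<close> lies in the ideal
    and, if nonzero, has smaller degree than \<open>d\<close>; so it is 0.\<close>
  have mult: "\<exists>c q. c \<noteq> 0 \<and> smult c g = d * q" if "g \<in> I" for g
  proof -
    obtain q r where qr: "pseudo_divmod g d = (q, r)" by fastforce
    note * = pseudo_divmod[OF d(2) qr]
    have "r = [:lead_coeff d ^ (Suc (degree g) - degree d):] * g + (- q) * d"
      using *(1) by (simp add: algebra_simps)
    then have "r \<in> I" using lin[OF that d(1)] by metis
    then have "r = 0" using *(2) dmin[of r] by fastforce
    then show ?thesis using *(1) d(2)
      by (intro exI[of _ "lead_coeff d ^ (Suc (degree g) - degree d)"] exI[of _ q]) auto
  qed
  have not_const: "\<not> f dvd [:c:]" if "c \<noteq> 0" for c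
  proof
    assume "f dvd [:c:]"
    then have "degree f \<le> degree [:c:]" using that by (intro dvd_imp_degree_le) auto
    then show False using deg by simp
  qed
  \<comment> \<open>\<open>f\<close> divides \<open>d * q\<close>, a constant multiple of itself. If
    it divides \<open>d\<close>, it divides a constant multiple of \<open>s\<close>, hence
    \<open>s\<close>; if it divides \<open>q\<close>, cancelling \<open>f\<close> shows that
    \<open>d\<close> divides a nonzero constant.\<close>
  have "degree d = 0"
  proof (rule ccontr)
    assume "degree d \<noteq> 0"
    obtain c q where cq: "c \<noteq> 0" "smult c f = d * q" using mult[OF fI] by blast
    then have "f dvd d * q" by (metis dvd_refl dvd_smult)
    with prime consider "f dvd d" | "f dvd q" by (auto simp: prime_elem_dvd_mult_iff)
    then show False
    proof cases
      case 1
      obtain k t where kt: "k \<noteq> 0" "smult k s = d * t" using mult[OF sI] by blast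
      have "f dvd [:k:] * s" using 1 kt(2) by simp
      then show False using prime_elem_dvd_multD[OF prime] ndvd not_const[OF kt(1)] by blast
    next
      case 2
      then obtain q' where q': "q = f * q'" by (elim dvdE)
      have "f * [:c:] = f * (d * q')" using cq(2) q' by (simp add: algebra_simps)
      then have "[:c:] = d * q'" using f0 mult_left_cancel by blast
      then have "d dvd [:c:]" by simp
      then have "degree d \<le> degree [:c:]" using cq(1) by (intro dvd_imp_degree_le) auto
      then show False using \<open>degree d \<noteq> 0\<close> by simp
    qed
  qed
  then obtain r where "d = [:r:]" using degree_eq_zeroE by blast
  moreover obtain u v where "d = u * f + v * s" using d(1) unfolding I_def by blast
  ultimately show ?thesis using that d(2) by simp
qed

text \<open>
  Applied with \<open>vanish\<close> the predicate of vanishing on a given irreducible algebraic set.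
\<close>

lemma irreducible_divisor_vanishing:
  fixes P :: "'a::idom poly"
  assumes lc: "lead_coeff P dvd 1" and "vanish P"
    and mult: "\<And>g h. vanish (g * h) \<Longrightarrow> vanish g \<or> vanish h"
    and unit: "\<And>u. u dvd 1 \<Longrightarrow> \<not> vanish u"
  obtains F where "Factorial_Ring.irreducible F" "F dvd P" "vanish F"
proof -
  define F where "F = arg_min degree (\<lambda>g. g dvd P \<and> vanish g)"
  have F: "F dvd P" "vanish F"
    using arg_min_natI[of "\<lambda>g. g dvd P \<and> vanish g" P degree] assms(2) by (auto simp: F_def)
  have Fmin: "degree F \<le> degree g" if "g dvd P" "vanish g" for g
    using arg_min_nat_le[of "\<lambda>g. g dvd P \<and> vanish g" g degree] that by (auto simp: F_def)
  \<comment> \<open>A unit leading coefficient passes to all divisors of \<open>P\<close>, so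
    divisors of degree 0 are units. Hence minimality of the degree of \<open>F\<close> is enough for
    irreducibility.\<close>
  have lcd: "lead_coeff g dvd 1" if "g dvd P" for g
  proof -
    obtain h where "P = g * h" using \<open>g dvd P\<close> by (elim dvdE)
    then show ?thesis using lc by (auto simp: lead_coeff_mult intro: dvd_mult_left)
  qed
  have const_unit: "h dvd 1" if "h dvd P" "degree h = 0" for h
  proof -
    obtain c where "h = [:c:]" using degree_eq_zeroE \<open>degree h = 0\<close> by blast
    with lcd[OF that(1)] show ?thesis by (simp add: is_unit_const_poly_iff)
  qed
  have F0: "F \<noteq> 0" using lcd[OF F(1)] by auto
  have "Factorial_Ring.irreducible F"
  proof (rule irreducibleI)
    show "F \<noteq> 0" by fact
    show "\<not> F dvd 1" using F(2) unit by blast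
    fix g h assume gh: "F = g * h"
    have *: "b dvd 1" if "F = a * b" "vanish a" for a b
    proof -
      have "a * b dvd P" using that(1) F(1) by simp
      then have ab: "a dvd P" "b dvd P" by (auto dest: dvd_mult_left dvd_mult_right)
      have "degree F = degree a + degree b"
        using that(1) F0 by (simp add: degree_mult_eq)
      then have "degree b = 0" using Fmin[OF ab(1) that(2)] by simp
      then show ?thesis by (rule const_unit[OF ab(2)])
    qed
    show "g dvd 1 \<or> h dvd 1"
      using mult[of g h] F(2) gh *[of g h] *[of h g] by (auto simp: mult.commute)
  qed
  then show ?thesis using F that by blast
qed

section \<open>Irreducible algebraic sets and prime polynomials\<close>

lemma zero_locus_mult: "zero_locus {P * Q} = zero_locus {P} \<union> zero_locus {Q}"
  by (auto simp: zero_locus_def)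

lemma algebraic_set_Int_zero_locus:
  assumes "algebraic_set V"
  shows "algebraic_set (V \<inter> zero_locus {P})"
proof -
  obtain S where "V = zero_locus S" using assms by (auto simp: algebraic_set_def)
  then have "V \<inter> zero_locus {P} = zero_locus (insert P S)" by (auto simp: zero_locus_def)
  then show ?thesis by (auto simp: algebraic_set_def)
qed

lemma irreducible_subset_mult:
  assumes "irreducible_algebraic_set V" and "V \<subseteq> zero_locus {P * Q}"
  shows "V \<subseteq> zero_locus {P} \<or> V \<subseteq> zero_locus {Q}"
proof -
  have "V = (V \<inter> zero_locus {P}) \<union> (V \<inter> zero_locus {Q})"
    using assms(2) by (auto simp: zero_locus_mult)
  moreover have "algebraic_set (V \<inter> zero_locus {P})" "algebraic_set (V \<inter> zero_locus {Q})"
    using assms(1) by (auto simp: irreducible_algebraic_set_def intro: algebraic_set_Int_zero_locus)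
  ultimately show ?thesis
    using assms(1) unfolding irreducible_algebraic_set_def by blast
qed

text \<open>The Nullstellensatz for a monic prime: if \<open>F\<close> did not divide
  \<open>D\<close>, elimination would give a nonzero polynomial in \<open>x\<close> that vanishes
  below every point of the curve \<open>F = 0\<close>, hence at every \<open>x\<close>.\<close>

lemma prime_dvd_if_vanishes:
  assumes "prime_elem F" "lead_coeff F = 1" "degree F > 0"
    and "zero_locus {F} \<subseteq> zero_locus {D}"
  shows "F dvd D"
proof (rule ccontr)
  assume "\<not> F dvd D"
  from prime_elem_elimination[OF assms(1,3) this]
  obtain u v r where r: "r \<noteq> 0" "u * F + v * D = [:r:]" .
  have "poly r x = 0" for x
  proof -
    obtain y where y: "poly2 F (x, y) = 0" using monic_root_on_line[OF assms(2,3)] .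
    then have "poly2 D (x, y) = 0" using assms(4) by (auto simp: zero_locus_def)
    then have "poly2 (u * F + v * D) (x, y) = 0" using y by simp
    then show ?thesis by (simp only: r(2)) simp
  qed
  then show False using r(1) poly_all_0_iff_0 by blast
qed

text \<open>If the curve were a union of two proper algebraic subsets, some equation
  \<open>a\<close> of the first and \<open>b\<close> of the second would fail on it, while
  \<open>a * b\<close> vanishes on it; this contradicts primality.\<close>

lemma irreducible_zero_locus_prime:
  assumes "prime_elem F" "lead_coeff F = 1" "degree F > 0"
  shows "irreducible_algebraic_set (zero_locus {F})"
  unfolding irreducible_algebraic_set_def
proof (intro conjI allI impI)
  show "algebraic_set (zero_locus {F})" by (auto simp: algebraic_set_def)
  obtain y where "poly2 F (0, y) = 0" using monic_root_on_line[OF assms(2,3)] .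
  then show "zero_locus {F} \<noteq> {}" by (auto simp: zero_locus_def)
  fix A B assume *: "algebraic_set A \<and> algebraic_set B \<and> zero_locus {F} = A \<union> B"
  then obtain S T where ST: "A = zero_locus S" "B = zero_locus T" by (auto simp: algebraic_set_def)
  show "zero_locus {F} = A \<or> zero_locus {F} = B"
  proof (rule ccontr)
    assume "\<not> ?thesis"
    then have "\<not> zero_locus {F} \<subseteq> A" "\<not> zero_locus {F} \<subseteq> B" using * by auto
    then obtain a b where ab: "a \<in> S" "b \<in> T"
      "\<not> zero_locus {F} \<subseteq> zero_locus {a}" "\<not> zero_locus {F} \<subseteq> zero_locus {b}"
      unfolding ST by (auto simp: zero_locus_def)
    have "zero_locus {F} \<subseteq> zero_locus {a * b}"
      using * ab(1,2) ST by (auto simp: zero_locus_def)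
    then have "F dvd a * b" using prime_dvd_if_vanishes assms by blast
    then consider "F dvd a" | "F dvd b" using assms(1) by (auto simp: prime_elem_dvd_mult_iff)
    then show False using ab(3,4) by cases (auto simp: zero_locus_def elim!: dvdE)
  qed
qed

section \<open>Descent to integral equations\<close>

lemma clear_denominators:
  obtains N :: int and q :: "int poly" where "N \<noteq> 0" "smult (of_int N) (map_poly of_rat p) = (map_poly of_int q :: complex poly)"
proof -
  have "\<exists>N (q :: int poly). N \<noteq> 0 \<and> smult (of_int N) (map_poly of_rat p) = (map_poly of_int q :: complex poly)"
  proof (induction p)
    case 0
    show ?case by (intro exI[of _ 1] exI[of _ 0]) simp
  next
    case (pCons a p)
    then obtain N q where Nq: "N \<noteq> 0" "smult (of_int N) (map_poly of_rat p) = (map_poly of_int q :: complex poly)"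
      by blast
    obtain n d where nd: "quotient_of a = (n, d)" by (cases "quotient_of a")
    note a = quotient_of_div[OF nd] and d = quotient_of_denom_pos[OF nd]
    have a': "of_int d * of_rat a = (of_int n :: complex)"
      using d unfolding a by (simp add: of_rat_divide)
    have "smult (of_int (d * N)) (map_poly of_rat (pCons a p)) = (map_poly of_int (pCons (N * n) (smult d q)) :: complex poly)"
    proof (rule poly_eqI)
      fix i
      have "of_int N * (of_rat (coeff p j) :: complex) = of_int (coeff q j)" for j
        using arg_cong[OF Nq(2), of "\<lambda>r. coeff r j"] by (simp add: coeff_map_poly)
      then show "coeff (smult (of_int (d * N)) (map_poly of_rat (pCons a p))) i =
          (coeff (map_poly of_int (pCons (N * n) (smult d q))) i :: complex)"
        using a' by (cases i) (simp_all add: coeff_map_poly mult.assoc mult.left_commute)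
    qed
    then show ?case using Nq(1) d by (intro exI[of _ "d * N"] exI[of _ "pCons (N * n) (smult d q)"]) simp
  qed
  then show ?thesis using that by blast
qed

text \<open>Only zero sets matter for being defined over the rationals, so each rational equation
  may be traded for an integral multiple of it.\<close>

lemma clear_denominators2:
  "\<exists>Q :: int poly poly. \<forall>z. poly2 (complexify Q) z = 0 \<longleftrightarrow> poly2 (map_poly (map_poly of_rat) P) z = 0"
proof -
  have "\<exists>N (Q :: int poly poly). N \<noteq> 0 \<and>
     (\<forall>z. poly2 (complexify Q) z = of_int N * poly2 (map_poly (map_poly of_rat) P) z)"
  proof (induction P)
    case 0
    show ?case by (intro exI[of _ 1] exI[of _ 0]) simp
  next
    case (pCons p P)
    then obtain N Q where NQ: "N \<noteq> 0"
      "\<And>z. poly2 (complexify Q) z = of_int N * poly2 (map_poly (map_poly of_rat) P) z" by blast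
    obtain n q where nq: "n \<noteq> 0" "smult (of_int n) (map_poly of_rat p) = (map_poly of_int q :: complex poly)"
      by (rule clear_denominators[of p])
    have q: "poly (map_poly of_int q) x = (of_int n * poly (map_poly of_rat p) x :: complex)" for x
      by (simp flip: nq(2))
    have c: "map_poly of_int (smult c r) = smult (of_int c) (map_poly of_int r :: complex poly)" for c and r :: "int poly"
      by (rule poly_eqI) (simp add: coeff_map_poly)
    have c2: "complexify [:[:n:]:] = [:[:of_int n:]:]"
      by (simp add: map_poly_pCons)
    have "poly2 (complexify (pCons (smult N q) ([:[:n:]:] * Q))) z =
        of_int (n * N) * poly2 (map_poly (map_poly of_rat) (pCons p P)) z" for z
      unfolding complexify_pCons complexify_mult c2 poly2_pCons poly2_mult NQ(2)
      by (simp add: c q map_poly_pCons algebra_simps)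
    then show ?case using NQ(1) nq(1) by (metis mult_eq_0_iff)
  qed
  then show ?thesis by (metis mult_eq_0_iff of_int_eq_0_iff)
qed

text \<open>For degree reasons \<open>f\<close> does not divide its derivative in \<open>y\<close>,
  so elimination puts a nonzero \<open>r\<close> in \<open>x\<close> alone into the ideal of the
  two. Where \<open>r\<close> does not vanish, the specialized polynomial has no multiple
  root.\<close>

lemma int_prime_distinct_roots:
  fixes f :: "int poly poly"
  assumes "prime_elem f" "degree f > 0" "lead_coeff f = 1"
  obtains x where "card {y. poly2 (complexify f) (x, y) = 0} = degree f"
proof -
  have "\<not> f dvd pderiv f"
  proof
    assume "f dvd pderiv f"
    moreover have "pderiv f \<noteq> 0" using assms(2) by (simp add: pderiv_eq_0_iff)
    ultimately have "degree f \<le> degree (pderiv f)" by (rule dvd_imp_degree_le)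
    then show False using assms(2) by (simp add: degree_pderiv)
  qed
  from prime_elem_elimination[OF assms(1,2) this]
  obtain u v r where r: "r \<noteq> 0" "u * f + v * pderiv f = [:r:]" .
  define R where "R = (map_poly of_int r :: complex poly)"
  have "R \<noteq> 0" using r(1) by (auto simp: R_def map_poly_eq_0_iff)
  then obtain x where x: "poly R x \<noteq> 0" using poly_all_0_iff_0 by blast
  define g where "g = map_poly (\<lambda>c. poly c x) (complexify f)"
  have degg: "degree g = degree f"
    unfolding g_def using assms(3) by (subst map_poly_monic) (simp_all add: coeff_complexify)
  have g: "poly2 (complexify f) (x, y) = poly g y" for y
    by (simp add: g_def poly2_eq_poly_slice)
  have g': "poly2 (complexify (pderiv f)) (x, y) = poly (pderiv g) y" for y
  proof -
    have "poly2 (complexify (pderiv h)) (x, y) = poly (pderiv (map_poly (\<lambda>c. poly c x) (complexify h))) y" for h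
      by (induction h) (simp_all add: pderiv_pCons map_poly_pCons poly2_eq_poly_slice[symmetric])
    then show ?thesis by (simp add: g_def)
  qed
  have "rsquarefree g"
    unfolding rsquarefree_roots
  proof (intro allI notI)
    fix y assume *: "poly g y = 0 \<and> poly (pderiv g) y = 0"
    have "poly2 (complexify (u * f + v * pderiv f)) (x, y) = 0"
      using * by (simp add: g g')
    then show False using x unfolding r(2) by (simp add: R_def)
  qed
  moreover have "g \<noteq> 0" using assms(2) degg by auto
  moreover have "finite {y. poly g y = 0}" using \<open>g \<noteq> 0\<close> by (rule poly_roots_finite)
  ultimately have "proots g = mset_set {y. poly g y = 0}"
    by (intro multiset_eqI) (simp add: count_mset_set' rsquarefree_root_order order_0I)
  then have "card {y. poly g y = 0} = degree g"
    by (metis size_mset_set size_proots_complex)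
  then show ?thesis using that[of x] by (simp add: g degg)
qed

lemma component_defined_over_Q:
  fixes P :: "int poly poly"
  assumes P: "lead_coeff P = 1"
    and comp: "irreducible_component V (zero_locus {complexify P})"
    and Q: "defined_over_Q V"
  obtains f :: "int poly poly" where "lead_coeff f = 1" "degree f > 0" "prime_elem (complexify f)"
    "V = zero_locus {complexify f}"
proof -
  have irr: "irreducible_algebraic_set V" and VP: "V \<subseteq> zero_locus {complexify P}"
    and max: "\<And>V'. irreducible_algebraic_set V' \<Longrightarrow> V \<subseteq> V' \<Longrightarrow> V' \<subseteq> zero_locus {complexify P} \<Longrightarrow> V' = V"
    using comp by (auto simp: irreducible_component_def)
  have ne: "V \<noteq> {}" using irr by (simp add: irreducible_algebraic_set_def)
  have unit: "\<not> V \<subseteq> zero_locus {u}" if "u dvd 1" for u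
  proof -
    obtain w where "u * w = 1" using \<open>u dvd 1\<close> by (metis dvdE)
    then have "poly2 u z * poly2 w z = 1" for z by (metis poly2_1 poly2_mult)
    then have "poly2 u z \<noteq> 0" for z by (metis mult_zero_left zero_neq_one)
    then show ?thesis using ne by (auto simp: zero_locus_def)
  qed
  have eP: "lead_coeff (complexify P) = 1" using P by (simp add: coeff_complexify)
  obtain F0 where F0: "Factorial_Ring.irreducible F0" "F0 dvd complexify P" "V \<subseteq> zero_locus {F0}"
    by (rule irreducible_divisor_vanishing[of "complexify P" "\<lambda>F. V \<subseteq> zero_locus {F}"])
      (use eP VP unit irreducible_subset_mult[OF irr] in auto)
  have "lead_coeff F0 dvd 1"
  proof -
    obtain h where "complexify P = F0 * h" using F0(2) by (elim dvdE)
    then have "lead_coeff F0 * lead_coeff h = 1" using eP by (simp add: lead_coeff_mult)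
    then show ?thesis by (metis dvd_triv_left)
  qed
  then obtain c where c: "lead_coeff F0 * c = 1" by (metis dvdE)
  \<comment> \<open>\<open>c\<close> is the inverse of the leading coefficient of \<open>F0\<close>,
    so \<open>F\<close> is its monic associate.\<close>
  define F where "F = smult c F0"
  have Fd: "F0 dvd F" "F dvd F0"
  proof -
    show "F0 dvd F" unfolding F_def by (rule dvd_smult) simp
    have "F0 = smult (lead_coeff F0) F" using c by (simp add: F_def)
    then show "F dvd F0" by (metis dvd_smult dvd_refl)
  qed
  have zF: "zero_locus {F} = zero_locus {F0}"
  proof -
    obtain a b where "F = F0 * a" "F0 = F * b" using Fd by (metis dvdE)
    then have "poly2 F z = poly2 F0 z * poly2 a z" "poly2 F0 z = poly2 F z * poly2 b z" for z
      by (metis poly2_mult)+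
    then have "poly2 F z = 0 \<longleftrightarrow> poly2 F0 z = 0" for z by (metis mult_zero_left)
    then show ?thesis by (simp add: zero_locus_def)
  qed
  have lF: "lead_coeff F = 1" using c by (cases "c = 0") (simp_all add: F_def mult.commute)
  have pF: "prime_elem F"
  proof -
    have "prime_elem F0" using F0(1) by (rule irreducible_imp_prime_elem)
    then show ?thesis
      using Fd unfolding prime_elem_def
      by (meson dvd_trans dvd_0_left_iff)
  qed
  have dF: "degree F > 0"
  proof (rule ccontr)
    assume "\<not> degree F > 0"
    then have "F = 1" using lF by (metis degree_0_id gr0I one_pCons)
    then show False using pF by simp
  qed
  \<comment> \<open>\<open>V\<close> lies in the irreducible set of zeros of \<open>F\<close>, which
    lies in the curve; maximality of the component gives equality.\<close>
  have VF: "V = zero_locus {F}"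
  proof -
    have "zero_locus {F0} \<subseteq> zero_locus {complexify P}"
      using F0(2) by (auto simp: zero_locus_def elim!: dvdE)
    then show ?thesis
      using max[OF irreducible_zero_locus_prime[OF pF lF dF]] F0(3) zF by simp
  qed
  have line: "\<exists>y. (x, y) \<in> V" for x
    using monic_root_on_line[OF lF dF, of x] by (auto simp: VF zero_locus_def)

  have mult: "V \<subseteq> zero_locus {complexify g} \<or> V \<subseteq> zero_locus {complexify h}"
    if "V \<subseteq> zero_locus {complexify (g * h)}" for g h
    using irreducible_subset_mult[OF irr, of "complexify g" "complexify h"] that by simp
  have unit_int: "\<not> V \<subseteq> zero_locus {complexify u}" if "u dvd 1" for u
  proof -
    obtain w where "1 = u * w" using \<open>u dvd 1\<close> by (elim dvdE)
    then have "1 = complexify u * complexify w" by (metis complexify_1 complexify_mult)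
    then show ?thesis by (intro unit) (metis dvd_triv_left)
  qed
  obtain f0 where f0: "Factorial_Ring.irreducible f0" "f0 dvd P" "V \<subseteq> zero_locus {complexify f0}"
    by (rule irreducible_divisor_vanishing[of P "\<lambda>f. V \<subseteq> zero_locus {complexify f}"])
      (use P VP unit_int mult in auto)
  obtain h where "P = f0 * h" using f0(2) by (elim dvdE)
  then have "lead_coeff f0 * lead_coeff h = 1" using P by (simp add: lead_coeff_mult)
  then have lf0: "lead_coeff f0 dvd 1" by (metis dvd_triv_left)
  \<comment> \<open>The units of the ring of integral polynomials in \<open>x\<close> are 1 and -1,
    so a change of sign makes \<open>f0\<close> monic.\<close>
  have "lead_coeff f0 = 1 \<or> lead_coeff f0 = -1"
  proof -
    obtain a where a: "lead_coeff f0 = [:a:]" "a dvd 1"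
      using lf0 by (auto simp: is_unit_poly_iff)
    from a(2) have "a = 1 \<or> a = -1" by auto
    then show ?thesis using a(1) by (auto simp: one_pCons)
  qed
  define f where "f = (if lead_coeff f0 = 1 then f0 else - f0)"
  have f: "lead_coeff f = 1" "prime_elem f" "V \<subseteq> zero_locus {complexify f}"
    using \<open>lead_coeff f0 = 1 \<or> lead_coeff f0 = -1\<close> irreducible_imp_prime_elem[OF f0(1)] f0(3)
    by (auto simp: f_def zero_locus_def prime_elem_def)
  have df: "degree f > 0"
  proof (rule ccontr)
    assume "\<not> degree f > 0"
    then have "f = 1" using f(1) by (metis degree_0_id gr0I one_pCons)
    then show False using f(2) by simp
  qed
  \<comment> \<open>Elimination again: \<open>V\<close> meets every vertical line, so the eliminant
    \<open>r\<close> would vanish identically.\<close>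
  have dvd: "f dvd s" if "V \<subseteq> zero_locus {complexify s}" for s
  proof (rule ccontr)
    assume "\<not> f dvd s"
    from prime_elem_elimination[OF f(2) df this]
    obtain u v r where r: "r \<noteq> 0" "u * f + v * s = [:r:]" .
    have "poly (map_poly of_int r) x = (0 :: complex)" for x
    proof -
      obtain y where "(x, y) \<in> V" using line by blast
      then have "poly2 (complexify (u * f + v * s)) (x, y) = 0"
        using f(3) that by (force simp: zero_locus_def)
      then show ?thesis by (simp only: r(2)) simp
    qed
    then have "map_poly of_int r = (0 :: complex poly)" using poly_all_0_iff_0 by blast
    then show False using r(1) by (simp add: map_poly_eq_0_iff)
  qed
  obtain S :: "rat poly poly set" where S: "V = zero_locus (map_poly (map_poly of_rat) ` S)"
    using Q by (auto simp: defined_over_Q_def)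
  \<comment> \<open>Here rationality of \<open>V\<close> enters: each rational equation of
    \<open>V\<close> has the zeros of an integral one, which \<open>f\<close> divides.\<close>
  have Vf: "V = zero_locus {complexify f}"
  proof (rule antisym[OF f(3)], rule subsetI)
    fix z assume z: "z \<in> zero_locus {complexify f}"
    have "poly2 (map_poly (map_poly of_rat) s) z = 0" if "s \<in> S" for s
    proof -
      obtain t where t: "\<And>z. poly2 (complexify t) z = 0 \<longleftrightarrow> poly2 (map_poly (map_poly of_rat) s) z = 0"
        using clear_denominators2[of s] by blast
      have "V \<subseteq> zero_locus {complexify t}" using \<open>s \<in> S\<close> by (auto simp: S zero_locus_def t)
      from dvd[OF this] obtain w where "t = f * w" by (elim dvdE)
      then have "poly2 (complexify t) z = 0" using z by (simp add: zero_locus_def)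
      then show ?thesis by (simp add: t)
    qed
    then show "z \<in> V" by (auto simp: S zero_locus_def)
  qed
  have lef: "lead_coeff (complexify f) = 1" using f(1) by (simp add: coeff_complexify)
  obtain k where k: "complexify f = F * k"
    using prime_dvd_if_vanishes[OF pF lF dF, of "complexify f"] VF Vf by (auto elim: dvdE)
  obtain x where x: "card {y. poly2 (complexify f) (x, y) = 0} = degree f"
    using int_prime_distinct_roots[OF f(2) df f(1)] .
  \<comment> \<open>The \<open>degree f\<close> points of \<open>V\<close> on this line are roots of
    the specialized \<open>F\<close>. Hence \<open>degree f\<close> is at most
    \<open>degree F\<close>, and the monic cofactor \<open>k\<close> is 1.\<close>
  have "{y. poly2 (complexify f) (x, y) = 0} = {y. (x, y) \<in> V}" by (auto simp: Vf zero_locus_def)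
  also have "\<dots> = {y. poly (map_poly (\<lambda>c. poly c x) F) y = 0}"
    by (auto simp: VF zero_locus_def poly2_eq_poly_slice)
  finally have "degree f = card {y. poly (map_poly (\<lambda>c. poly c x) F) y = 0}" using x by simp
  also have "\<dots> \<le> degree (map_poly (\<lambda>c. poly c x) F)"
    using dF map_poly_monic[of F "\<lambda>c. poly c x"] lF by (intro card_poly_roots_bound) auto
  also have "\<dots> = degree F" using lF by (intro map_poly_monic) auto
  finally have "degree (complexify f) \<le> degree F" by simp
  moreover have "k \<noteq> 0" "F \<noteq> 0" using lef k by auto
  ultimately have "degree k = 0" using k by (simp add: degree_mult_eq del: degree_complexify)
  moreover have "lead_coeff k = 1" using k lef lF by (simp add: lead_coeff_mult)
  ultimately have "k = 1" by (metis degree_0_id one_pCons)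
  then have "prime_elem (complexify f)" using k pF by simp
  then show ?thesis using that[OF f(1) df] Vf by blast
qed

section \<open>Pairs of matrices of determinant one\<close>

text \<open>For determinant 1 this is the inverse; the formula makes it an integral combination of
  the identity and the matrix, with the trace as coefficient.\<close>

definition adjugate :: "complex^2^2 \<Rightarrow> complex^2^2" where
  "adjugate A = mat (trace A) - A"

lemmas mat2_simps = vec_eq_iff forall_2 matrix_matrix_mult_def sum_2 mat_def trace_def det_2

lemma mult_adjugate: "A ** adjugate A = mat (det A)" and adjugate_mult: "adjugate A ** A = mat (det A)"
  and det_adjugate: "det (adjugate A) = det A"
  by (simp_all add: adjugate_def mat2_simps algebra_simps)

lemma SL2_simps [simp]:
  "A \<in> carrier SL2 \<longleftrightarrow> det A = 1" "x \<otimes>\<^bsub>SL2\<^esub> y = x ** y" "\<one>\<^bsub>SL2\<^esub> = mat 1"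
  by (simp_all add: SL2_def)

lemma group_SL2: "group SL2"
proof (rule groupI)
  show "\<exists>y\<in>carrier SL2. y \<otimes>\<^bsub>SL2\<^esub> x = \<one>\<^bsub>SL2\<^esub>" if "x \<in> carrier SL2" for x
    using that by (intro bexI[of _ "adjugate x"]) (simp_all add: adjugate_mult det_adjugate)
qed (simp_all add: det_mul matrix_mul_assoc)

lemma inv_SL2: "det A = 1 \<Longrightarrow> inv\<^bsub>SL2\<^esub> A = adjugate A"
  by (rule group.inv_equality[OF group_SL2]) (simp_all add: adjugate_mult det_adjugate)

section \<open>Words and presentations\<close>

context group
begin

lemma word_eval_closed:
  assumes "range \<gamma> \<subseteq> carrier G"
  shows "word_eval G \<gamma> w \<in> carrier G"
proof -
  have "\<gamma> x \<in> carrier G" for x using assms by auto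
  then show ?thesis unfolding word_eval_def by (induction w) auto
qed

lemma word_eval_append:
  assumes "range \<gamma> \<subseteq> carrier G"
  shows "word_eval G \<gamma> (u @ v) = word_eval G \<gamma> u \<otimes> word_eval G \<gamma> v"
proof (induction u)
  case Nil
  show ?case using word_eval_closed[OF assms] by (simp add: word_eval_def)
next
  case (Cons l u)
  have "\<gamma> x \<in> carrier G" for x using assms by auto
  with Cons show ?case
    using word_eval_closed[OF assms, of u] word_eval_closed[OF assms, of v]
    by (auto simp: word_eval_def m_assoc split: prod.splits)
qed

lemma word_eval_pres_eq:
  assumes \<gamma>: "range \<gamma> \<subseteq> carrier G"
    and R: "\<And>u v. (u, v) \<in> R \<Longrightarrow> word_eval G \<gamma> u = word_eval G \<gamma> v"
    and "pres_eq R u v"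
  shows "word_eval G \<gamma> u = word_eval G \<gamma> v"
  using assms(3)
proof induction
  case (cancel a x s b)
  have "\<gamma> x \<in> carrier G" using \<gamma> by auto
  then have "word_eval G \<gamma> [(x, s), (x, \<not> s)] = \<one>" by (simp add: word_eval_def)
  then show ?case using word_eval_closed[OF \<gamma>] by (simp only: word_eval_append[OF \<gamma>]) simp
qed (simp_all add: word_eval_append[OF \<gamma>] R)

end

lemma hom_word_eval:
  assumes G: "group G" "group H" and h: "h \<in> hom G H" and \<gamma>: "range \<gamma> \<subseteq> carrier G"
  shows "h (word_eval G \<gamma> w) = word_eval H (h \<circ> \<gamma>) w"
proof -
  interpret group_hom G H h using assms by (simp add: group_hom_def group_hom_axioms_def)
  have \<gamma>': "\<gamma> x \<in> carrier G" for x using \<gamma> by auto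
  show ?thesis
  proof (induction w)
    case Nil
    show ?case by (simp add: word_eval_def)
  next
    case (Cons l w)
    then show ?case using G.word_eval_closed[OF \<gamma>, of w] \<gamma>'
      by (auto simp: word_eval_def split: prod.splits)
  qed
qed

text \<open>The universal property of a presentation. The value at \<open>g\<close> is computed from
  an arbitrary word for \<open>g\<close>; any two such words are related by \<open>pres_eq R\<close>
  and hence have the same value in \<open>H\<close>.\<close>

lemma hom_from_presentation:
  assumes pres: "is_presentation G \<gamma> R" and H: "group H" and \<delta>: "range \<delta> \<subseteq> carrier H"
    and R: "\<And>u v. (u, v) \<in> R \<Longrightarrow> word_eval H \<delta> u = word_eval H \<delta> v"
  obtains h where "h \<in> hom G H" "\<And>w. h (word_eval G \<gamma> w) = word_eval H \<delta> w"
proof -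
  have G: "group G" and \<gamma>: "range \<gamma> \<subseteq> carrier G"
    and surj: "\<And>g. g \<in> carrier G \<Longrightarrow> \<exists>w. word_eval G \<gamma> w = g"
    and eq: "\<And>u v. word_eval G \<gamma> u = word_eval G \<gamma> v \<longleftrightarrow> pres_eq R u v"
    using pres by (auto simp: is_presentation_def)
  define h where "h g = word_eval H \<delta> (SOME w. word_eval G \<gamma> w = g)" for g
  have h: "h (word_eval G \<gamma> w) = word_eval H \<delta> w" for w
  proof -
    have "word_eval G \<gamma> (SOME v. word_eval G \<gamma> v = word_eval G \<gamma> w) = word_eval G \<gamma> w"
      by (rule someI_ex) blast
    then show ?thesis
      unfolding h_def by (intro group.word_eval_pres_eq[OF H \<delta> R]) (auto simp: eq)
  qed
  have "h \<in> hom G H"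
  proof (rule homI)
    fix x y assume "x \<in> carrier G" "y \<in> carrier G"
    then obtain u v where uv: "x = word_eval G \<gamma> u" "y = word_eval G \<gamma> v" using surj by metis
    show "h x \<in> carrier H" unfolding uv h by (rule group.word_eval_closed[OF H \<delta>])
    show "h (x \<otimes>\<^bsub>G\<^esub> y) = h x \<otimes>\<^bsub>H\<^esub> h y"
      unfolding uv group.word_eval_append[OF G \<gamma>, symmetric] h by (rule group.word_eval_append[OF H \<delta>])
  qed
  then show ?thesis using that h by blast
qed

section \<open>Words in two matrices of determinant one\<close>

definition word_matrix :: "complex^2^2 \<Rightarrow> complex^2^2 \<Rightarrow> two_bridge_gen word \<Rightarrow> complex^2^2" where
  "word_matrix A B = word_eval SL2 (case_two_bridge_gen A B)"

fun letter_matrix :: "complex^2^2 \<Rightarrow> complex^2^2 \<Rightarrow> two_bridge_gen \<times> bool \<Rightarrow> complex^2^2" where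
  "letter_matrix A B (Mu, s) = (if s then A else adjugate A)"
| "letter_matrix A B (Beta, s) = (if s then B else adjugate B)"

lemma word_matrix_Nil [simp]: "word_matrix A B [] = mat 1"
  by (simp add: word_matrix_def word_eval_def)

lemma word_matrix_Cons:
  assumes "det A = 1" "det B = 1"
  shows "word_matrix A B (l # w) = letter_matrix A B l ** word_matrix A B w"
  using assms by (cases "(A, B, l)" rule: letter_matrix.cases) (simp_all add: word_matrix_def word_eval_def inv_SL2)

lemma word_matrix_append:
  assumes "det A = 1" "det B = 1"
  shows "word_matrix A B (u @ v) = word_matrix A B u ** word_matrix A B v"
  by (induction u) (simp_all add: word_matrix_Cons assms matrix_mul_assoc)

lemma det_word_matrix:
  assumes "det A = 1" "det B = 1"
  shows "det (word_matrix A B w) = 1"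
proof (induction w)
  case (Cons l w)
  then show ?case by (cases "(A, B, l)" rule: letter_matrix.cases) (simp_all add: word_matrix_Cons assms det_mul det_adjugate)
qed simp

abbreviation var_x :: "int poly poly" where "var_x \<equiv> [:[:0, 1:]:]"
abbreviation var_y :: "int poly poly" where "var_y \<equiv> [:0, 1:]"

type_synonym quad = "int poly poly \<times> int poly poly \<times> int poly poly \<times> int poly poly"

text \<open>
  A quadruple stands for the matrix with these coordinates with respect to \<open>1, A, B, B A\<close>, where
  \<open>var_x = tr A = tr B\<close> and \<open>var_y = tr (A B)\<close>. The four equations express left multiplication by
  \<open>A\<close>, \<open>A\<^sup>-\<^sup>1 = x - A\<close>, \<open>B\<close>, \<open>B\<^sup>-\<^sup>1 = x - B\<close> and follow from Cayley--Hamilton in the forms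
  \<open>A\<^sup>2 = x A - 1\<close>, \<open>A B + B A = x (A + B) + y - x\<^sup>2\<close>.
\<close>

fun letter_action :: "two_bridge_gen \<times> bool \<Rightarrow> quad \<Rightarrow> quad" where
  "letter_action (Mu, True) (a, b, c, d) = (- b + (var_y - var_x\<^sup>2) * c - var_x * d, a + var_x * b + var_x * c + var_y * d, var_x * c + d, - c)"
| "letter_action (Mu, False) (a, b, c, d) = (var_x * a + b - (var_y - var_x\<^sup>2) * c + var_x * d, - a - var_x * c - var_y * d, - d, var_x * d + c)"
| "letter_action (Beta, True) (a, b, c, d) = (- c, - d, a + var_x * c, b + var_x * d)"
| "letter_action (Beta, False) (a, b, c, d) = (var_x * a + c, var_x * b + d, - a, - b)"

definition combination :: "complex^2^2 \<Rightarrow> complex^2^2 \<Rightarrow> complex \<times> complex \<Rightarrow> quad \<Rightarrow> complex^2^2" where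
  "combination A B z = (\<lambda>(a, b, c, d). mat (poly2 (complexify a) z) + mat (poly2 (complexify b) z) ** A +
     mat (poly2 (complexify c) z) ** B + mat (poly2 (complexify d) z) ** (B ** A))"

lemma eval_var_x: "poly2 (complexify var_x) z = fst z" and eval_var_y: "poly2 (complexify var_y) z = snd z"
  by (simp_all add: map_poly_pCons)

lemma mult_mat_left_commute: "A ** (mat k ** M) = mat k ** (A ** M)" for A M :: "complex^2^2"
  by (simp add: mat2_simps algebra_simps)

lemma mult_mat_commute: "A ** mat k = mat k ** A" for A :: "complex^2^2"
  by (simp add: mat2_simps algebra_simps)

lemma mat2_diff_ldistrib: "A ** (M - N) = A ** M - A ** N"
  and mat2_diff_rdistrib: "(M - N) ** A = M ** A - N ** A" for A M N :: "complex^2^2"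
  by (simp_all add: mat2_simps algebra_simps)

lemma mat2_add_rdistrib: "(M + N) ** A = M ** A + N ** A" for A M N :: "complex^2^2"
  by (simp add: mat2_simps algebra_simps)

text \<open>The table for left multiplication by \<open>A\<close> on \<open>A\<close>,
  \<open>B\<close>, \<open>B A\<close>: Cayley--Hamilton, its polarization, and the expansion of
  \<open>(A B) A\<close> by means of these two.\<close>

lemma mat2_relations:
  fixes A B :: "complex^2^2"
  assumes "det A = 1" "trace A = x" "trace B = x" "trace (A ** B) = y"
  shows "A ** A = mat x ** A - mat 1"
    and "A ** B = mat (y - x\<^sup>2) + mat x ** A + mat x ** B - B ** A"
    and "A ** (B ** A) = mat y ** A + B - mat x"
proof -
  have x: "x = A $ 1 $ 1 + A $ 2 $ 2" unfolding assms(2)[symmetric] by (simp add: mat2_simps)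
  have b: "B $ 2 $ 2 = A $ 1 $ 1 + A $ 2 $ 2 - B $ 1 $ 1"
    using assms(3) unfolding x trace_def sum_2 by (metis add_diff_cancel_left')
  have y: "y = A $ 1 $ 1 * B $ 1 $ 1 + A $ 1 $ 2 * B $ 2 $ 1 + A $ 2 $ 1 * B $ 1 $ 2 + A $ 2 $ 2 * B $ 2 $ 2"
    unfolding assms(4)[symmetric] by (simp add: mat2_simps)
  show AA: "A ** A = mat x ** A - mat 1"
    unfolding x using assms(1) by (simp add: mat2_simps algebra_simps)
  show AB: "A ** B = mat (y - x\<^sup>2) + mat x ** A + mat x ** B - B ** A"
    unfolding x y by (simp add: mat2_simps b algebra_simps power2_eq_square)
  define M where "M = B ** A"
  have BAA: "B ** (A ** A) = mat x ** M - B"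
    unfolding AA M_def by (simp add: mat2_diff_ldistrib mult_mat_left_commute)
  have "A ** (B ** A) = (A ** B) ** A" by (rule matrix_mul_assoc)
  also have "\<dots> = mat (y - x\<^sup>2) ** A + mat x ** (A ** A) + mat x ** M - B ** (A ** A)"
    unfolding AB M_def by (simp add: mat2_diff_rdistrib mat2_add_rdistrib flip: matrix_mul_assoc)
  also have "\<dots> = mat y ** A + B - mat x"
    unfolding BAA unfolding AA by (simp add: mat2_simps algebra_simps power2_eq_square)
  finally show "A ** (B ** A) = mat y ** A + B - mat x" .
qed

lemma combination_act:
  assumes "det A = 1" "det B = 1" "trace A = x" "trace B = x" "trace (A ** B) = y"
  shows "combination A B (x, y) (letter_action l v) = letter_matrix A B l ** combination A B (x, y) v"
proof -
  obtain a b c d where v: "v = (a, b, c, d)" by (cases v)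
  have yx: "trace (B ** A) = y" using assms(5) trace_mul_sym[of A B] by simp
  have BBA: "B ** (B ** A) = mat x ** (B ** A) - A"
  proof -
    have "B ** (B ** A) = (B ** B) ** A" by (rule matrix_mul_assoc)
    also have "\<dots> = (mat x ** B - mat 1) ** A"
      using mat2_relations(1)[OF assms(2,4,3) yx] by simp
    also have "\<dots> = mat x ** (B ** A) - A"
      by (simp add: mat2_diff_rdistrib flip: matrix_mul_assoc)
    finally show ?thesis .
  qed
  have BB: "B ** B = mat x ** B - mat 1" by (rule mat2_relations(1)[OF assms(2,4,3) yx])
  have eval_var_x_square: "poly2 (complexify (var_x\<^sup>2)) (x, y) = x\<^sup>2"
    unfolding power2_eq_square by (simp only: complexify_mult poly2_mult eval_var_x fst_conv)
  \<comment> \<open>The product is kept atomic, so that comparing entries below only has to match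
    coordinates.\<close>
  define M where "M = B ** A"
  note rel = mat2_relations[OF assms(1,3-5), folded M_def] BB BBA[folded M_def] M_def[symmetric]
  obtain \<alpha> \<beta> \<gamma> \<delta> where abcd: "poly2 (complexify a) (x, y) = \<alpha>" "poly2 (complexify b) (x, y) = \<beta>"
    "poly2 (complexify c) (x, y) = \<gamma>" "poly2 (complexify d) (x, y) = \<delta>" by blast
  have AV: "A ** combination A B (x, y) v = mat \<alpha> ** A + mat \<beta> ** (mat x ** A - mat 1) +
      mat \<gamma> ** (mat (y - x\<^sup>2) + mat x ** A + mat x ** B - M) + mat \<delta> ** (mat y ** A + B - mat x)"
    by (simp add: v combination_def abcd matrix_add_ldistrib mult_mat_left_commute mult_mat_commute rel del: mat_0)
  have BV: "B ** combination A B (x, y) v = mat \<alpha> ** B + mat \<beta> ** M +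
      mat \<gamma> ** (mat x ** B - mat 1) + mat \<delta> ** (mat x ** M - A)"
    by (simp add: v combination_def abcd matrix_add_ldistrib mult_mat_left_commute mult_mat_commute rel del: mat_0)
  \<comment> \<open>Inverse letters reduce to the products \<open>AV\<close> and \<open>BV\<close>
    of the positive ones.\<close>
  have adj: "adjugate C ** N = mat x ** N - C ** N" if "trace C = x" for C N :: "complex^2^2"
    using that by (simp add: adjugate_def mat2_diff_rdistrib)
  note ev = complexify_add complexify_diff complexify_mult complexify_uminus poly2_add poly2_diff poly2_mult poly2_uminus
    eval_var_x eval_var_y eval_var_x_square fst_conv snd_conv abcd
  have V: "combination A B (x, y) v = mat \<alpha> + mat \<beta> ** A + mat \<gamma> ** B + mat \<delta> ** M"
    by (simp add: v combination_def abcd M_def)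
  consider "l = (Mu, True)" | "l = (Mu, False)" | "l = (Beta, True)" | "l = (Beta, False)"
    by (metis (full_types) prod.exhaust two_bridge_gen.exhaust)
  then show ?thesis
  proof cases
    case 1
    have "combination A B (x, y) (letter_action l v) =
      mat (- \<beta> + (y - x\<^sup>2) * \<gamma> - x * \<delta>) + mat (\<alpha> + x * \<beta> + x * \<gamma> + y * \<delta>) ** A + mat (x * \<gamma> + \<delta>) ** B + mat (- \<gamma>) ** M"
      unfolding 1 v letter_action.simps combination_def prod.case ev M_def ..
    then show ?thesis by (simp add: 1 AV) (simp add: mat2_simps algebra_simps)
  next
    case 2
    have "combination A B (x, y) (letter_action l v) =
      mat (x * \<alpha> + \<beta> - (y - x\<^sup>2) * \<gamma> + x * \<delta>) + mat (- \<alpha> - x * \<gamma> - y * \<delta>) ** A + mat (- \<delta>) ** B + mat (x * \<delta> + \<gamma>) ** M"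
      unfolding 2 v letter_action.simps combination_def prod.case ev M_def ..
    then show ?thesis by (simp add: 2 adj assms AV) (simp add: V mat2_simps algebra_simps)
  next
    case 3
    have "combination A B (x, y) (letter_action l v) =
      mat (- \<gamma>) + mat (- \<delta>) ** A + mat (\<alpha> + x * \<gamma>) ** B + mat (\<beta> + x * \<delta>) ** M"
      unfolding 3 v letter_action.simps combination_def prod.case ev M_def ..
    then show ?thesis by (simp add: 3 BV) (simp add: mat2_simps algebra_simps)
  next
    case 4
    have "combination A B (x, y) (letter_action l v) =
      mat (x * \<alpha> + \<gamma>) + mat (x * \<beta> + \<delta>) ** A + mat (- \<alpha>) ** B + mat (- \<beta>) ** M"
      unfolding 4 v letter_action.simps combination_def prod.case ev M_def ..
    then show ?thesis by (simp add: 4 adj assms BV) (simp add: V mat2_simps algebra_simps)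
  qed
qed

lemma combination_foldr_act:
  assumes "det A = 1" "det B = 1" "trace A = x" "trace B = x" "trace (A ** B) = y"
  shows "combination A B (x, y) (foldr letter_action w v) = word_matrix A B w ** combination A B (x, y) v"
  by (induction w) (simp_all add: combination_act[OF assms] word_matrix_Cons assms matrix_mul_assoc)

lemma trace_comb:
  assumes "trace A = x" "trace B = x" "trace (A ** B) = y"
  shows "trace (combination A B (x, y) (a, b, c, d)) = poly2 (complexify (2 * a + var_x * b + var_x * c + var_y * d)) (x, y)"
proof -
  have 2: "poly2 (complexify 2) z = 2" for z
    by (metis complexify_1 complexify_add one_add_one poly2_1 poly2_add)
  show ?thesis
    unfolding complexify_add complexify_mult poly2_add poly2_mult eval_var_x eval_var_y 2
  proof -
    obtain \<alpha> \<beta> \<gamma> \<delta> where abcd: "poly2 (complexify a) (x, y) = \<alpha>" "poly2 (complexify b) (x, y) = \<beta>"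
      "poly2 (complexify c) (x, y) = \<gamma>" "poly2 (complexify d) (x, y) = \<delta>" by blast
    have *: "trace (mat k ** M) = k * trace M" "trace (mat k :: complex^2^2) = 2 * k" for k and M :: "complex^2^2"
      by (simp_all add: trace_def matrix_matrix_mult_def mat_def sum_2 algebra_simps)
    show "trace (combination A B (x, y) (a, b, c, d)) = 2 * poly2 (complexify a) (x, y) +
        fst (x, y) * poly2 (complexify b) (x, y) + fst (x, y) * poly2 (complexify c) (x, y) + snd (x, y) * poly2 (complexify d) (x, y)"
      unfolding combination_def prod.case abcd fst_conv snd_conv
      using assms by (simp add: trace_add * trace_mul_sym[of B A])
  qed
qed

section \<open>The palindromic symmetry of the two-bridge word\<close>

definition swap_gen :: "two_bridge_gen \<times> bool \<Rightarrow> two_bridge_gen \<times> bool" where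
  "swap_gen = map_prod (case_two_bridge_gen Beta Mu) id"

lemma letter_matrix_swap_gen: "letter_matrix A B (swap_gen l) = letter_matrix B A l"
  by (cases "(A, B, l)" rule: letter_matrix.cases) (simp_all add: swap_gen_def)

lemma word_matrix_map_swap_gen:
  assumes "det A = 1" "det B = 1"
  shows "word_matrix A B (map swap_gen w) = word_matrix B A w"
  by (induction w) (simp_all add: word_matrix_Cons assms letter_matrix_swap_gen)

text \<open>As \<open>p\<close> does not divide \<open>i * q\<close>, the quotients for
  \<open>i\<close> and \<open>p - i\<close> add up to \<open>q - 1\<close>, which is even; so the
  exponents agree. As \<open>p\<close> is odd, \<open>i\<close> and \<open>p - i\<close> have
  opposite parity; so the generators are exchanged.\<close>

lemma rev_two_bridge_word:
  assumes "odd p" "odd q" "coprime p q" "0 < q" "q < p"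
  shows "rev (two_bridge_word p q) = map swap_gen (two_bridge_word p q)"
proof (rule nth_equalityI)
  show "length (rev (two_bridge_word p q)) = length (map swap_gen (two_bridge_word p q))" by simp
  fix j assume "j < length (rev (two_bridge_word p q))"
  then have j: "j < p - 1" by (simp add: two_bridge_word_def)
  \<comment> \<open>List positions start at 0, the exponents at 1.\<close>
  define i where "i = Suc j"
  have i: "0 < i" "i < p" using j by (auto simp: i_def)
  have "i * q mod p \<noteq> 0"
  proof
    assume "i * q mod p = 0"
    then have "p dvd i" using assms(3) by (auto simp: coprime_dvd_mult_left_iff)
    then show False using i by (auto dest: dvd_imp_le)
  qed
  define k r where "k = i * q div p" and "r = i * q mod p"
  have kr: "i * q = k * p + r" "0 < r" "r < p"
    using \<open>i * q mod p \<noteq> 0\<close> i by (auto simp: k_def r_def)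
  have kq: "k < q"
  proof (rule ccontr)
    assume "\<not> k < q"
    then have "q * p \<le> k * p" by simp
    moreover have "i * q < q * p" using i assms by simp
    ultimately show False using kr(1) by linarith
  qed
  have "(p - i) * q = (q - 1 - k) * p + (p - r)"
  proof -
    obtain m where m: "q = k + 1 + m" using kq by (metis add.commute less_iff_Suc_add Suc_eq_plus1 add.assoc)
    obtain i' where i': "p = i + i'" using i less_imp_add_positive by blast
    obtain r' where r': "p = r + r'" using kr(3) less_imp_add_positive by blast
    have "i * q + i' * q = p * q" unfolding i' by (simp add: algebra_simps)
    also have "\<dots> = k * p + m * p + (r + r')" unfolding r'[symmetric] m by (simp add: algebra_simps)
    finally have "i' * q = m * p + r'" using kr(1) by simp
    moreover have "p - i = i'" "p - r = r'" using i' r' by simp_all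
    moreover have "q - 1 - k = m" using m by simp
    ultimately show ?thesis by simp
  qed
  then have div: "(p - i) * q div p = q - 1 - k"
    using kr(2,3) by (metis add.commute diff_less div_less div_mult_self1 gr_implies_not0 plus_nat.add_0 zero_less_diff order.strict_trans)
  have ek: "even (q - 1 - k) \<longleftrightarrow> even k" using kq assms(2) by (simp add: even_diff_nat)
  have oi: "odd (p - i) \<longleftrightarrow> even i" using i assms(1) by simp
  have nth: "two_bridge_word p q ! (l - 1) = (if odd l then Beta else Mu, even (l * q div p))"
    if "0 < l" "l < p" for l
    using that by (simp add: two_bridge_word_def nth_upt)
  have len: "length (two_bridge_word p q) = p - 1" by (simp add: two_bridge_word_def)
  have "rev (two_bridge_word p q) ! j = two_bridge_word p q ! (p - i - 1)"
    using j by (simp add: rev_nth len i_def)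
  also have "\<dots> = (if odd (p - i) then Beta else Mu, even ((p - i) * q div p))"
    using i by (intro nth) simp_all
  also have "\<dots> = swap_gen (if odd i then Beta else Mu, even k)"
    unfolding div ek oi by (simp add: swap_gen_def)
  also have "\<dots> = swap_gen (two_bridge_word p q ! (i - 1))"
    using nth[OF i] by (simp add: k_def)
  also have "\<dots> = map swap_gen (two_bridge_word p q) ! j"
    using j by (simp add: len i_def)
  finally show "rev (two_bridge_word p q) ! j = map swap_gen (two_bridge_word p q) ! j" .
qed

section \<open>The Riley polynomial\<close>

definition mat22 :: "complex \<Rightarrow> complex \<Rightarrow> complex \<Rightarrow> complex \<Rightarrow> complex^2^2" where
  "mat22 a b c d = vector [vector [a, b], vector [c, d]]"

lemma mat22_nth [simp]:
  "mat22 a b c d $ 1 $ 1 = a" "mat22 a b c d $ 1 $ 2 = b"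
  "mat22 a b c d $ 2 $ 1 = c" "mat22 a b c d $ 2 $ 2 = d"
  by (simp_all add: mat22_def)

section \<open>The intertwiner \<open>J = A + B - x\<close>\<close>

lemma combination_init: "combination A B (x, y) (- var_x, 1, 1, 0) = A + B - mat x"
  by (simp add: combination_def map_poly_pCons) (simp add: mat2_simps)

text \<open>By Cayley--Hamilton both sides equal \<open>B A - 1\<close>.\<close>

lemma intertwine:
  fixes A B :: "complex^2^2"
  assumes "det A = 1" "det B = 1" "trace A = x" "trace B = x"
  shows "(A + B - mat x) ** A = B ** (A + B - mat x)"
proof -
  have "A ** A = mat x ** A - mat 1" "B ** B = mat x ** B - mat 1"
    using mat2_relations(1)[OF assms(1,3,4) HOL.refl] mat2_relations(1)[OF assms(2,4,3) HOL.refl] by simp_all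
  then show ?thesis
    by (simp add: mat2_diff_rdistrib mat2_add_rdistrib mat2_diff_ldistrib matrix_add_ldistrib mult_mat_commute)
qed

text \<open>\<open>J\<close> is symmetric in \<open>A\<close> and \<open>B\<close>, so it exchanges
  them in both directions; inverses follow because \<open>A\<close> and \<open>B\<close> have the
  same trace.\<close>

lemma intertwine_letter_matrix:
  assumes "det A = 1" "det B = 1" "trace A = x" "trace B = x"
  shows "(A + B - mat x) ** letter_matrix A B l = letter_matrix B A l ** (A + B - mat x)"
proof -
  note 1 = intertwine[OF assms] intertwine[OF assms(2,1,4,3), unfolded add.commute[of B A]]
  have 2: "M ** adjugate A = adjugate B ** M" "M ** adjugate B = adjugate A ** M"
    if "M ** A = B ** M" "M ** B = A ** M" for M :: "complex^2^2"
    using that assms by (simp_all add: adjugate_def mat2_diff_ldistrib mat2_diff_rdistrib mult_mat_commute)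
  show ?thesis using 1 2[OF 1] by (cases "(A, B, l)" rule: letter_matrix.cases) simp_all
qed

lemma intertwine_word_matrix:
  assumes "det A = 1" "det B = 1" "trace A = x" "trace B = x"
  shows "(A + B - mat x) ** word_matrix A B w = word_matrix B A w ** (A + B - mat x)"
proof (induction w)
  case (Cons l w)
  have "(A + B - mat x) ** word_matrix A B (l # w) = ((A + B - mat x) ** letter_matrix A B l) ** word_matrix A B w"
    by (simp add: word_matrix_Cons assms matrix_mul_assoc)
  also have "\<dots> = letter_matrix B A l ** ((A + B - mat x) ** word_matrix A B w)"
    by (simp add: intertwine_letter_matrix[OF assms] matrix_mul_assoc)
  also have "\<dots> = word_matrix B A (l # w) ** (A + B - mat x)"
    by (simp add: Cons word_matrix_Cons assms matrix_mul_assoc)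
  finally show ?case .
qed simp

lemma symmetric_mat2_iff: "transpose A = A \<longleftrightarrow> A $ 2 $ 1 = A $ 1 $ 2" for A :: "complex^2^2"
  by (auto simp: vec_eq_iff forall_2 Finite_Cartesian_Product.transpose_def)

lemma transpose_word_matrix:
  assumes "det A = 1" "det B = 1" "transpose A = A" "transpose B = B"
  shows "transpose (word_matrix A B w) = word_matrix A B (rev w)"
proof (induction w)
  case (Cons l w)
  have "transpose (letter_matrix A B l) = letter_matrix A B l"
    using assms(3,4) by (cases "(A, B, l)" rule: letter_matrix.cases)
      (simp_all add: symmetric_mat2_iff adjugate_def mat_def)
  then show ?case
    by (simp add: word_matrix_Cons word_matrix_append assms matrix_transpose_mul Cons)
qed simp

text \<open>
  For symmetric \<open>A\<close> and \<open>B\<close>, transposition is the anti-automorphism that reverses words.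
\<close>

lemma symmetric_pair:
  obtains A B :: "complex^2^2" where "det A = 1" "det B = 1" "trace A = x" "trace B = x" "trace (A ** B) = y"
    "transpose A = A" "transpose B = B" "y \<noteq> 2 \<longrightarrow> y \<noteq> x\<^sup>2 - 2 \<longrightarrow> A ** B \<noteq> B ** A"
proof -
  \<comment> \<open>With \<open>A\<close> and \<open>B\<close> of the shape below,
    \<open>det A = 1\<close> and \<open>tr (A B) = y\<close> amount to
    \<open>u\<^sup>2 + v\<^sup>2 = x\<^sup>2 - 4\<close> and
    \<open>u\<^sup>2 - v\<^sup>2 = 2 y - x\<^sup>2\<close>. The two matrices commute only if
    \<open>u v = 0\<close>.\<close>
  define u v where "u = csqrt (y - 2)" and "v = csqrt (x\<^sup>2 - 2 - y)"
  have uv: "u * u = y - 2" "v * v = x\<^sup>2 - 2 - y"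
    by (simp_all add: u_def v_def flip: power2_eq_square)
  define A B where "A = mat22 ((x + u) / 2) (v / 2) (v / 2) ((x - u) / 2)"
    and "B = mat22 ((x + u) / 2) (- v / 2) (- v / 2) ((x - u) / 2)"
  have "(x + u) * (x - u) - v * v = x * x - u * u - v * v" by (simp add: algebra_simps)
  also have "\<dots> = 4" unfolding uv by (simp add: power2_eq_square)
  finally have *: "(x + u) * (x - u) - v * v = 4" .
  have "det A = 1" "det B = 1" using * by (simp_all add: A_def B_def det_2 field_simps)
  moreover have "trace A = x" "trace B = x" by (simp_all add: A_def B_def mat2_simps field_simps)
  moreover have "trace (A ** B) = y"
  proof -
    have "trace (A ** B) = (2 * (x * x) + 2 * (u * u) - 2 * (v * v)) / 4"
      by (simp add: A_def B_def mat2_simps field_simps)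
    then show ?thesis unfolding uv by (simp add: power2_eq_square)
  qed
  moreover have "transpose A = A" "transpose B = B"
    by (simp_all add: symmetric_mat2_iff A_def B_def)
  moreover have "A ** B \<noteq> B ** A" if "y \<noteq> 2" "y \<noteq> x\<^sup>2 - 2"
  proof
    assume "A ** B = B ** A"
    then have "(A ** B) $ 1 $ 2 = (B ** A) $ 1 $ 2" by simp
    then have "u * v = 0" by (simp add: A_def B_def matrix_matrix_mult_def sum_2 field_simps)
    then show False using uv that by auto
  qed
  ultimately show ?thesis by (intro that) blast+
qed

section \<open>The coordinates of \<open>W J\<close> and the equation of the curve\<close>

lemma poly2_all_0:
  assumes "\<And>z. poly2 P z = 0"
  shows "P = 0"
proof (rule poly_eqI)
  fix i
  have "map_poly (\<lambda>c. poly c x) P = 0" for x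
    using assms poly_all_0_iff_0 unfolding poly2_eq_poly_slice by (metis poly2_eq_poly_slice)
  then have "coeff (map_poly (\<lambda>c. poly c x) P) i = 0" for x by simp
  then have "\<forall>x. poly (coeff P i) x = 0" by (simp add: coeff_map_poly)
  then show "coeff P i = coeff 0 i" using poly_all_0_iff_0[of "coeff P i"] by simp
qed

text \<open>
  The coordinates of \<open>W J\<close>, where \<open>W\<close> is the value of the word and \<open>J = A + B - x\<close>. Since
  \<open>J A = B J\<close>, the relation \<open>W B = A W\<close> says that \<open>W J\<close> commutes with \<open>A\<close> if \<open>J\<close> is invertible.
\<close>

definition riley :: "two_bridge_gen word \<Rightarrow> quad" where
  "riley w = foldr letter_action w (- var_x, 1, 1, 0)"

lemma combination_riley:
  assumes "det A = 1" "det B = 1" "trace A = x" "trace B = x" "trace (A ** B) = y"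
  shows "combination A B (x, y) (riley w) = word_matrix A B w ** (A + B - mat x)"
  unfolding riley_def combination_foldr_act[OF assms] combination_init ..

text \<open>For symmetric \<open>A\<close>, \<open>B\<close>, transposing \<open>W J\<close>
  reverses the word, which exchanges the generators, and moving \<open>J\<close> across exchanges
  them back; so \<open>W J\<close> is symmetric. Of \<open>1, A, B, B A\<close> only the last fails
  to be symmetric, unless \<open>A\<close> and \<open>B\<close> commute.\<close>

lemma riley_symmetric:
  assumes w: "rev w = map swap_gen w" and abcd: "riley w = (a, b, c, d)"
  shows "d = 0"
proof -
  \<comment> \<open>\<open>Q = (y - 2) (y - x\<^sup>2 + 2)\<close> vanishes wherever the symmetric
    pair may commute, so \<open>d * Q\<close> vanishes on the whole plane.\<close>
  define Q :: "complex poly poly" where "Q = [:[:-2:], 1:] * [:[:2, 0, -1:], 1:]"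
  have "poly2 (complexify d * Q) z = 0" for z
  proof -
    obtain x y where z: "z = (x, y)" by (cases z)
    obtain A B :: "complex^2^2" where AB: "det A = 1" "det B = 1" "trace A = x" "trace B = x" "trace (A ** B) = y"
      and sym: "transpose A = A" "transpose B = B"
      and comm: "y \<noteq> 2 \<longrightarrow> y \<noteq> x\<^sup>2 - 2 \<longrightarrow> A ** B \<noteq> B ** A"
      using symmetric_pair[of x y] .
    define J where "J = A + B - mat x"
    define \<alpha> \<beta> \<gamma> \<delta> where abcd': "\<alpha> = poly2 (complexify a) (x, y)" "\<beta> = poly2 (complexify b) (x, y)"
      "\<gamma> = poly2 (complexify c) (x, y)" "\<delta> = poly2 (complexify d) (x, y)"
    have tA: "A $ 2 $ 1 = A $ 1 $ 2" "B $ 2 $ 1 = B $ 1 $ 2"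
      using sym by (simp_all add: symmetric_mat2_iff)
    have tJ: "transpose J = J" using tA by (simp add: J_def symmetric_mat2_iff mat_def)
    have "transpose (word_matrix A B w ** J) = J ** word_matrix A B (map swap_gen w)"
      by (simp add: matrix_transpose_mul tJ transpose_word_matrix AB sym w)
    also have "\<dots> = word_matrix A B w ** J"
      unfolding word_matrix_map_swap_gen[OF AB(1,2)] J_def
      using intertwine_word_matrix[OF AB(2,1,4,3)] by (simp add: add.commute[of B A])
    finally have "transpose (word_matrix A B w ** J) = word_matrix A B w ** J" .
    then have "transpose (combination A B (x, y) (a, b, c, d)) = combination A B (x, y) (a, b, c, d)"
      using combination_riley[OF AB, of w] by (simp add: abcd J_def)
    then have "\<delta> * ((B ** A) $ 2 $ 1) = \<delta> * ((B ** A) $ 1 $ 2)"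
      using tA unfolding symmetric_mat2_iff by (simp add: combination_def abcd'[symmetric] mat_def matrix_matrix_mult_def sum_2)
    then have "\<delta> = 0 \<or> (B ** A) $ 2 $ 1 = (B ** A) $ 1 $ 2" by simp
    then have "\<delta> = 0 \<or> A ** B = B ** A"
      using tA by (auto simp: mat2_simps algebra_simps)
    moreover have "poly2 Q (x, y) = (y - 2) * (y - (x\<^sup>2 - 2))"
      unfolding Q_def poly2_mult by (simp add: algebra_simps power2_eq_square)
    ultimately show ?thesis
      using comm unfolding z poly2_mult abcd' by auto
  qed
  then have "complexify d * Q = 0" by (rule poly2_all_0)
  moreover have "Q \<noteq> 0" by (simp add: Q_def)
  ultimately show ?thesis by simp
qed

lemma word_matrix_commute:
  assumes "det A = 1" "det B = 1" "C ** A = A ** C" "C ** B = B ** C"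
  shows "C ** word_matrix A B w = word_matrix A B w ** C"
proof (induction w)
  case (Cons l w)
  have "C ** letter_matrix A B l = letter_matrix A B l ** C"
    using assms by (cases "(A, B, l)" rule: letter_matrix.cases)
      (simp_all add: adjugate_def mat2_diff_ldistrib mat2_diff_rdistrib mult_mat_commute)
  then show ?case using Cons
    by (simp add: word_matrix_Cons assms) (metis matrix_mul_assoc)
qed simp

lemma word_matrix_upper_triangular:
  assumes "det A = 1" "det B = 1" "A $ 2 $ 1 = 0" "B $ 2 $ 1 = 0"
  shows "word_matrix A B w $ 2 $ 1 = 0"
proof (induction w)
  case Nil
  show ?case by (simp add: mat_def)
next
  case (Cons l w)
  have "letter_matrix A B l $ 2 $ 1 = 0"
    using assms by (cases "(A, B, l)" rule: letter_matrix.cases) (simp_all add: adjugate_def mat_def)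
  then show ?case using Cons by (simp add: word_matrix_Cons assms matrix_matrix_mult_def sum_2)
qed

lemma mat2_right_cancel:
  fixes M N K :: "complex^2^2"
  assumes "M ** K = N ** K" "det K \<noteq> 0"
  shows "M = N"
proof -
  have "(M ** K) ** adjugate K = (N ** K) ** adjugate K" by (simp add: assms)
  then have "M ** mat (det K) = N ** mat (det K)" by (simp flip: matrix_mul_assoc add: mult_adjugate)
  then show ?thesis using assms(2) by (simp add: mat2_simps)
qed

lemma mat2_left_cancel:
  fixes M N K :: "complex^2^2"
  assumes "K ** M = K ** N" "det K \<noteq> 0"
  shows "M = N"
proof -
  have "adjugate K ** (K ** M) = adjugate K ** (K ** N)" by (simp add: assms)
  then have "mat (det K) ** M = mat (det K) ** N" by (simp add: adjugate_mult matrix_mul_assoc)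
  then show ?thesis using assms(2) by (simp add: mat2_simps)
qed

lemma trace_eq_of_conj:
  fixes A B W :: "complex^2^2"
  assumes "det W = 1" "W ** B = A ** W"
  shows "trace B = trace A"
proof -
  have "trace B = trace (adjugate W ** (W ** B))" by (simp add: matrix_mul_assoc adjugate_mult assms(1))
  also have "\<dots> = trace (adjugate W ** (A ** W))" by (simp only: assms(2))
  also have "\<dots> = trace ((A ** W) ** adjugate W)" by (rule trace_mul_sym)
  also have "\<dots> = trace A" by (simp add: mult_adjugate assms(1) flip: matrix_mul_assoc)
  finally show ?thesis .
qed

text \<open>
  The value \<open>y = 2\<close> is where \<open>J\<close> is singular. There a triangular pair turns \<open>J\<close> into a matrix unit.
\<close>

lemma riley_no_zero:
  assumes abcd: "riley w = (a, b, c, 0)" and "x\<^sup>2 \<noteq> 4"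
  shows "poly2 (complexify c) (x, 2) \<noteq> 0"
proof
  assume c: "poly2 (complexify c) (x, 2) = 0"
  define u where "u = csqrt (x\<^sup>2 - 4)"
  have u: "u * u = x\<^sup>2 - 4" by (simp add: u_def flip: power2_eq_square)
  then have u0: "u \<noteq> 0" using assms(2) by auto
  \<comment> \<open>The eigenvalues of a matrix with trace \<open>x\<close> and determinant 1,
    distinct because \<open>x\<^sup>2 \<noteq> 4\<close>. Placing them in opposite order in
    \<open>A\<close> and \<open>B\<close> gives \<open>tr (A B) = 2 m n = 2\<close>.\<close>
  define m n where "m = (x + u) / 2" and "n = (x - u) / 2"
  have mn: "m + n = x" "m * n = 1" "m - n = u"
    using u by (simp_all add: m_def n_def field_simps power2_eq_square)
  define A B where "A = mat22 m 1 0 n" and "B = mat22 n 0 0 m"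
  have AB: "det A = 1" "det B = 1" "trace A = x" "trace B = x" "trace (A ** B) = 2"
    using mn by (simp_all add: A_def B_def mat2_simps mult.commute add.commute)
  define W where "W = word_matrix A B w"
  have W: "W $ 2 $ 1 = 0" unfolding W_def
    by (rule word_matrix_upper_triangular) (simp_all add: AB(1,2), simp_all add: A_def B_def)
  define \<alpha> \<beta> where ab: "\<alpha> = poly2 (complexify a) (x, 2)" "\<beta> = poly2 (complexify b) (x, 2)"
  have J: "A + B - mat x = mat22 0 1 0 0"
    using mn by (simp add: A_def B_def mat2_simps add.commute)
  have "mat \<alpha> + mat \<beta> ** A = W ** mat22 0 1 0 0"
    using combination_riley[OF AB, of w] c unfolding J abcd W_def combination_def ab by (simp add: mat_def[of 0] flip: zero_vec_def)
  \<comment> \<open>The entries of the previous equation. The diagonal ones force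
    \<open>\<beta> = 0\<close> as \<open>m \<noteq> n\<close>, so the first column of
    \<open>W\<close> vanishes, contrary to \<open>det W = 1\<close>.\<close>
  then have *: "\<alpha> + \<beta> * m = 0 \<and> W $ 1 $ 1 = \<beta> \<and> \<alpha> + \<beta> * n = 0"
    using W by (auto simp: A_def mat2_simps)
  have "\<beta> * (m - n) = (\<alpha> + \<beta> * m) - (\<alpha> + \<beta> * n)" by (simp add: algebra_simps)
  with * have "W $ 1 $ 1 = 0" using mn(3) u0 by simp
  moreover have "det W = 1" unfolding W_def by (rule det_word_matrix) (rule AB)+
  ultimately show False using W by (simp add: det_2)
qed

lemma relation_curve:
  assumes abcd: "riley w = (a, b, c, 0)"
  shows "(\<exists>A B. det A = 1 \<and> det B = 1 \<and> word_matrix A B w ** B = A ** word_matrix A B w \<and> x = trace A \<and> y = trace (A ** B)) \<longleftrightarrow>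
    y = x\<^sup>2 - 2 \<or> poly2 (complexify c) (x, y) = 0" (is "?L \<longleftrightarrow> ?R")
proof
  assume ?L
  then obtain A B where A: "det A = 1" "det B = 1" "trace A = x" "trace (A ** B) = y"
    and rel: "word_matrix A B w ** B = A ** word_matrix A B w" by auto
  define W where "W = word_matrix A B w"
  have dW: "det W = 1" unfolding W_def by (rule det_word_matrix) (rule A)+
  have tB: "trace B = x" using trace_eq_of_conj[OF dW, of B A] rel A(3) by (simp add: W_def)
  note AB = A(1,2,3) tB A(4)
  define J where "J = A + B - mat x"
  define \<alpha> \<beta> \<gamma> where ab: "\<alpha> = poly2 (complexify a) (x, y)" "\<beta> = poly2 (complexify b) (x, y)" "\<gamma> = poly2 (complexify c) (x, y)"
  have WJ: "W ** J = mat \<alpha> + mat \<beta> ** A + mat \<gamma> ** B"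
    using combination_riley[OF AB, of w] unfolding abcd W_def combination_def ab J_def by (simp add: mat_def[of 0] flip: zero_vec_def)
  \<comment> \<open>The relation and \<open>J A = B J\<close> make \<open>W J\<close> commute with
    \<open>A\<close>, and \<open>\<gamma> B\<close> is the only summand that could prevent
    this.\<close>
  have "(W ** J) ** A = W ** (J ** A)" by (simp add: matrix_mul_assoc)
  also have "\<dots> = (W ** B) ** J" unfolding J_def intertwine[OF AB(1-4)] by (simp add: matrix_mul_assoc)
  also have "\<dots> = A ** (W ** J)" using rel by (simp add: W_def matrix_mul_assoc)
  finally have "mat \<gamma> ** (B ** A) = mat \<gamma> ** (A ** B)"
    unfolding WJ by (simp add: mat2_add_rdistrib matrix_add_ldistrib mult_mat_commute mult_mat_left_commute flip: matrix_mul_assoc)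
  then have "\<gamma> = 0 \<or> B ** A = A ** B" by (cases "\<gamma> = 0") (simp_all add: mat2_simps)
  \<comment> \<open>In the commuting case \<open>W\<close> cancels from the relation, so
    \<open>A = B\<close>.\<close>
  moreover have "y = x\<^sup>2 - 2" if BA: "B ** A = A ** B"
  proof -
    have "A ** W = W ** A" unfolding W_def using A BA by (intro word_matrix_commute) simp_all
    then have "W ** B = W ** A" using rel by (simp add: W_def)
    then have "B = A" using dW mat2_left_cancel by force
    then have "y = trace (mat x ** A - mat 1)"
      using A(4) mat2_relations(1)[OF A(1,3) A(3) HOL.refl] by simp
    also have "\<dots> = x\<^sup>2 - 2" unfolding A(3)[symmetric] by (simp add: mat2_simps algebra_simps power2_eq_square)
    finally show ?thesis .
  qed
  ultimately show ?R by (auto simp: ab)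
next
  assume ?R
  \<comment> \<open>A zero of \<open>c\<close> with \<open>y = 2\<close> has
    \<open>x\<^sup>2 = 4\<close> by \<open>riley_no_zero\<close>, so it lies on
    \<open>y = x\<^sup>2 - 2\<close>. In the second case \<open>J\<close> is therefore
    invertible.\<close>
  consider "y = x\<^sup>2 - 2" | "poly2 (complexify c) (x, y) = 0" "y \<noteq> 2" "y \<noteq> x\<^sup>2 - 2"
    using \<open>?R\<close> riley_no_zero[OF abcd, of x] by (cases "y = 2"; cases "x\<^sup>2 = 4") auto
  then show ?L
  proof cases
    case 1
    \<comment> \<open>A companion matrix of trace \<open>x\<close>; the pair \<open>A = B\<close>
      satisfies the relation for every word.\<close>
    define A where "A = mat22 x (-1) 1 0"
    have A: "det A = 1" by (simp add: A_def det_2)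
    have "A ** word_matrix A A w = word_matrix A A w ** A" using A by (intro word_matrix_commute) simp_all
    moreover have "trace A = x" "trace (A ** A) = y"
      using 1 by (simp_all add: A_def mat2_simps power2_eq_square)
    ultimately show ?thesis using A by metis
  next
    case 2
    obtain A B :: "complex^2^2" where AB: "det A = 1" "det B = 1" "trace A = x" "trace B = x" "trace (A ** B) = y"
      using symmetric_pair[of x y] .
    define J W where "J = A + B - mat x" and "W = word_matrix A B w"
    define \<alpha> \<beta> where ab: "\<alpha> = poly2 (complexify a) (x, y)" "\<beta> = poly2 (complexify b) (x, y)"
    have WJ: "W ** J = mat \<alpha> + mat \<beta> ** A"
      using combination_riley[OF AB, of w] 2(1) unfolding abcd W_def combination_def ab J_def by (simp add: mat_def[of 0] flip: zero_vec_def)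
    have "(W ** B) ** J = W ** (J ** A)" unfolding J_def intertwine[OF AB(1-4)] by (simp add: matrix_mul_assoc)
    also have "\<dots> = (W ** J) ** A" by (simp add: matrix_mul_assoc)
    also have "\<dots> = A ** (W ** J)"
      unfolding WJ by (simp add: mat2_add_rdistrib matrix_add_ldistrib mult_mat_commute mult_mat_left_commute flip: matrix_mul_assoc)
    also have "\<dots> = (A ** W) ** J" by (rule matrix_mul_assoc)
    finally have "(W ** B) ** J = (A ** W) ** J" .
    moreover have "det J = 2 - y"
    proof -
      have "x = A $ 1 $ 1 + A $ 2 $ 2" using AB(3) by (simp add: mat2_simps)
      moreover have "B $ 2 $ 2 = A $ 1 $ 1 + A $ 2 $ 2 - B $ 1 $ 1"
        using AB(4) unfolding calculation trace_def sum_2 by (metis add_diff_cancel_left')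
      ultimately have "det J + trace (A ** B) = det A + det B"
        by (simp add: J_def mat2_simps algebra_simps)
      then show ?thesis unfolding AB by (simp add: algebra_simps)
    qed
    ultimately have "W ** B = A ** W" using 2(2) mat2_right_cancel by force
    then show ?thesis using AB unfolding W_def by metis
  qed
qed

section \<open>Degrees in \<open>y\<close>\<close>

lemma coeff_X_mult: "coeff (var_x * a) i = [:0, 1:] * coeff a i" and coeff_X2_mult: "coeff (var_x\<^sup>2 * a) i = [:0, 1:]\<^sup>2 * coeff a i"
  and coeff_Y_mult: "coeff (var_y * a) i = (case i of 0 \<Rightarrow> 0 | Suc j \<Rightarrow> coeff a j)"
  by (simp_all add: power2_eq_square coeff_pCons split: nat.splits)

text \<open>
  The degree bounds come from the grading in which \<open>A\<close> and \<open>B\<close> have weight 1 and \<open>y\<close> has weight 2: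
  up to terms of lower weight, \<open>A\<^sup>2 = B\<^sup>2 = 0\<close>, \<open>A\<^sup>-\<^sup>1 = - A\<close>, \<open>B\<^sup>-\<^sup>1 = - B\<close> and \<open>B A B = y B\<close>.
\<close>

lemma letter_action_Mu_degree:
  assumes "letter_action (Mu, s) (a, b, c, d) = (a', b', c', d')"
    and "\<And>i. i > k \<Longrightarrow> coeff a i = 0" "\<And>i. i > k \<Longrightarrow> coeff b i = 0" "\<And>i. i > k \<Longrightarrow> coeff c i = 0"
    and "\<And>i. i \<ge> k \<Longrightarrow> coeff d i = 0" and "coeff c k \<in> {1, -1}"
  shows "i > Suc k \<Longrightarrow> coeff a' i = 0" "i > k \<Longrightarrow> coeff b' i = 0" "i > k \<Longrightarrow> coeff c' i = 0"
    "i > k \<Longrightarrow> coeff d' i = 0" "coeff a' (Suc k) \<in> {1, -1}"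
  using assms
  by (cases s; auto simp: coeff_X_mult coeff_X2_mult coeff_Y_mult left_diff_distrib split: nat.splits simp del: mult_pCons_left)+

lemma letter_action_Beta_degree:
  assumes "letter_action (Beta, s) (a, b, c, d) = (a', b', c', d')"
    and "\<And>i. i > Suc k \<Longrightarrow> coeff a i = 0" "\<And>i. i > k \<Longrightarrow> coeff b i = 0" "\<And>i. i > k \<Longrightarrow> coeff c i = 0"
    and "\<And>i. i > k \<Longrightarrow> coeff d i = 0" and "coeff a (Suc k) \<in> {1, -1}"
  shows "i > Suc k \<Longrightarrow> coeff a' i = 0" "i > Suc k \<Longrightarrow> coeff b' i = 0" "i > Suc k \<Longrightarrow> coeff c' i = 0"
    "i \<ge> Suc k \<Longrightarrow> coeff d' i = 0" "coeff c' (Suc k) \<in> {1, -1}"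
  using assms
  by (cases s; auto simp: coeff_X_mult simp del: mult_pCons_left)+

text \<open>The letters act from the right. In each pair, \<open>Mu\<close> moves the top
  coefficient, up to sign, from \<open>c\<close> to \<open>a\<close> one degree higher, and
  \<open>Beta\<close> moves it back to \<open>c\<close>.\<close>

lemma riley_degree:
  assumes "w = concat (map (\<lambda>j. [(Beta, s j), (Mu, t j)]) js)" and "riley w = (a, b, c, d)"
  shows "(\<forall>i>length js. coeff a i = 0 \<and> coeff b i = 0 \<and> coeff c i = 0) \<and>
    (\<forall>i\<ge>length js. coeff d i = 0) \<and> coeff c (length js) \<in> {1, -1}"
  using assms
proof (induction js arbitrary: w a b c d)
  case Nil
  then show ?case by (auto simp: riley_def coeff_pCons one_pCons split: nat.splits)
next
  case (Cons j js)
  define w' where "w' = concat (map (\<lambda>j. [(Beta, s j), (Mu, t j)]) js)"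
  obtain a0 b0 c0 d0 where 0: "riley w' = (a0, b0, c0, d0)" by (cases "riley w'")
  obtain a1 b1 c1 d1 where 1: "letter_action (Mu, t j) (a0, b0, c0, d0) = (a1, b1, c1, d1)"
    by (cases "letter_action (Mu, t j) (a0, b0, c0, d0)")
  have 2: "letter_action (Beta, s j) (a1, b1, c1, d1) = (a, b, c, d)"
    using Cons.prems 0 1 by (simp add: riley_def w'_def)
  note IH = Cons.IH[OF w'_def 0]
  note d1 = letter_action_Mu_degree[OF 1, of "length js"]
  note d2 = letter_action_Beta_degree[OF 2, of "length js"]
  show ?case using IH d1 d2 by auto
qed

lemma map_upt_pairs: "map f [1..<2 * m + 1] = concat (map (\<lambda>j. [f (2 * j + 1), f (2 * j + 2)]) [0..<m])"
  by (induction m) simp_all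

lemma two_bridge_word_pairs:
  "two_bridge_word (2 * m + 1) q =
    concat (map (\<lambda>j. [(Beta, even ((2 * j + 1) * q div (2 * m + 1))), (Mu, even ((2 * j + 2) * q div (2 * m + 1)))]) [0..<m])"
  unfolding two_bridge_word_def map_upt_pairs by (rule arg_cong[where f = concat]) simp

section \<open>Characters of a two-bridge knot group\<close>

context
  fixes G :: "('g, 'm) monoid_scheme" and \<mu> \<beta> :: 'g and p q :: nat
  assumes pres: "two_bridge_presentation G \<mu> \<beta> p q"
begin

abbreviation (input) gens :: "two_bridge_gen \<Rightarrow> 'g" where
  "gens \<equiv> case_two_bridge_gen \<mu> \<beta>"

abbreviation (input) \<omega> :: "two_bridge_gen word" where
  "\<omega> \<equiv> two_bridge_word p q"

lemma presentation: "is_presentation G gens {two_bridge_relation p q}"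
  using pres by (simp add: two_bridge_presentation_def)

lemma group_G: "group G" and gens_closed: "range gens \<subseteq> carrier G"
  using presentation by (auto simp: is_presentation_def)

lemma generators_closed: "\<mu> \<in> carrier G" "\<beta> \<in> carrier G"
  using gens_closed[THEN subsetD, OF rangeI, of Mu] gens_closed[THEN subsetD, OF rangeI, of Beta] by simp_all

lemma word_eval_gens: "word_eval G gens [(Mu, True)] = \<mu>" "word_eval G gens [(Mu, True), (Beta, True)] = \<mu> \<otimes>\<^bsub>G\<^esub> \<beta>"
  using generators_closed group.is_monoid[OF group_G] by (simp_all add: word_eval_def monoid.r_one)

lemma word_matrix_relation:
  assumes "det A = 1" "det B = 1"
  shows "word_matrix A B (fst (two_bridge_relation p q)) = word_matrix A B \<omega> ** B"
    "word_matrix A B (snd (two_bridge_relation p q)) = A ** word_matrix A B \<omega>"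
  using assms by (simp_all add: two_bridge_relation_def word_matrix_append word_matrix_Cons)

lemma character_matrices:
  assumes "\<xi> \<in> char_variety G"
  obtains A B where "det A = 1" "det B = 1" "word_matrix A B \<omega> ** B = A ** word_matrix A B \<omega>" "trace B = trace A"
    "\<And>v. \<xi> (word_eval G gens v) = trace (word_matrix A B v)" "coords G \<mu> \<beta> \<xi> = (trace A, trace (A ** B))"
proof -
  obtain \<rho> where \<rho>: "\<rho> \<in> hom G SL2" and \<xi>: "\<xi> = character G \<rho>"
    using assms by (auto simp: char_variety_def)
  define A B where "A = \<rho> \<mu>" and "B = \<rho> \<beta>"
  have AB: "det A = 1" "det B = 1"
    using hom_in_carrier[OF \<rho>] generators_closed unfolding A_def B_def by auto
  have comp: "\<rho> \<circ> gens = case_two_bridge_gen A B"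
    by (auto simp: A_def B_def split: two_bridge_gen.splits)
  have ev: "\<rho> (word_eval G gens v) = word_matrix A B v" for v
    using hom_word_eval[OF group_G group_SL2 \<rho> gens_closed, of v] by (simp add: comp word_matrix_def)
  have "pres_eq {two_bridge_relation p q} (fst (two_bridge_relation p q)) (snd (two_bridge_relation p q))"
    using pres_eq.relation[of "fst (two_bridge_relation p q)" "snd (two_bridge_relation p q)" _ "[]" "[]"] by simp
  then have "word_eval G gens (fst (two_bridge_relation p q)) = word_eval G gens (snd (two_bridge_relation p q))"
    using presentation by (simp add: is_presentation_def)
  then have rel: "word_matrix A B \<omega> ** B = A ** word_matrix A B \<omega>"
    unfolding word_matrix_relation[OF AB, symmetric] by (metis ev)
  have val: "\<xi> (word_eval G gens v) = trace (word_matrix A B v)" for v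
    using group.word_eval_closed[OF group_G gens_closed, of v] by (simp add: \<xi> character_def ev)
  have "coords G \<mu> \<beta> \<xi> = (trace A, trace (A ** B))"
    using val[of "[(Mu, True)]"] val[of "[(Mu, True), (Beta, True)]"]
    unfolding word_eval_gens by (simp add: coords_def word_matrix_Cons AB)
  then show ?thesis
    using that AB rel val trace_eq_of_conj[OF det_word_matrix[OF AB] rel] by blast
qed

text \<open>By the universal property of the presentation, representations are the matrix pairs that
  satisfy the single relation.\<close>

lemma coords_char_variety:
  "(x, y) \<in> coords G \<mu> \<beta> ` char_variety G \<longleftrightarrow>
    (\<exists>A B. det A = 1 \<and> det B = 1 \<and> word_matrix A B \<omega> ** B = A ** word_matrix A B \<omega> \<and> x = trace A \<and> y = trace (A ** B))"
  (is "?L \<longleftrightarrow> ?R")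
proof
  assume ?L
  then obtain \<xi> where \<xi>: "\<xi> \<in> char_variety G" "coords G \<mu> \<beta> \<xi> = (x, y)" by (metis imageE)
  from character_matrices[OF \<xi>(1)] show ?R using \<xi>(2) by (metis prod.inject)
next
  assume ?R
  then obtain A B where AB: "det A = 1" "det B = 1" and rel: "word_matrix A B \<omega> ** B = A ** word_matrix A B \<omega>"
    and xy: "x = trace A" "y = trace (A ** B)" by blast
  let ?d = "case_two_bridge_gen A B"
  have d: "range ?d \<subseteq> carrier SL2" using AB by (auto split: two_bridge_gen.splits)
  have "word_eval SL2 ?d u = word_eval SL2 ?d v" if "(u, v) \<in> {two_bridge_relation p q}" for u v
    using word_matrix_relation[OF AB] rel that unfolding word_matrix_def by (metis fst_conv singletonD snd_conv)
  from hom_from_presentation[OF presentation group_SL2 d this]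
  obtain h where h: "h \<in> hom G SL2" "\<And>w. h (word_eval G gens w) = word_eval SL2 ?d w" by blast
  have "coords G \<mu> \<beta> (character G h) = (x, y)"
    using h(2)[of "[(Mu, True)]"] h(2)[of "[(Mu, True), (Beta, True)]"] generators_closed
      monoid.m_closed[OF group.is_monoid[OF group_G], of \<mu> \<beta>]
    unfolding word_eval_gens word_matrix_def[symmetric]
    by (simp add: coords_def character_def word_matrix_Cons AB xy)
  then show ?L using h(1) unfolding char_variety_def by (metis image_eqI)
qed

text \<open>Letting a word for \<open>g\<close> act on the coordinates of the identity matrix writes
  its value as an integral combination of \<open>1, A, B, B A\<close>, whose traces are
  \<open>2, x, x, y\<close>.\<close>

lemma character_polynomial:
  assumes "g \<in> carrier G"
  obtains Q :: "int poly poly" where "\<forall>\<xi>\<in>char_variety G. \<xi> g = poly2 (complexify Q) (coords G \<mu> \<beta> \<xi>)"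
proof -
  obtain v where v: "g = word_eval G gens v" using presentation assms unfolding is_presentation_def by metis
  obtain a b c d where abcd: "foldr letter_action v (1, 0, 0, 0) = (a, b, c, d)" by (cases "foldr letter_action v (1, 0, 0, 0)")
  have "\<xi> g = poly2 (complexify (2 * a + var_x * b + var_x * c + var_y * d)) (coords G \<mu> \<beta> \<xi>)" if \<xi>: "\<xi> \<in> char_variety G" for \<xi>
  proof -
    obtain A B where AB: "det A = 1" "det B = 1" "trace B = trace A"
      and val: "\<And>v. \<xi> (word_eval G gens v) = trace (word_matrix A B v)" "coords G \<mu> \<beta> \<xi> = (trace A, trace (A ** B))"
      using character_matrices[OF \<xi>] by metis
    have "combination A B z (1, 0, 0, 0) = mat 1" for z
      by (simp add: combination_def mat_def[of 0] flip: zero_vec_def)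
    then have "word_matrix A B v = combination A B (trace A, trace (A ** B)) (a, b, c, d)"
      using combination_foldr_act[OF AB(1,2) HOL.refl AB(3) HOL.refl, of v "(1, 0, 0, 0)"] by (simp add: abcd)
    then show ?thesis
      unfolding v val using trace_comb[OF HOL.refl AB(3) HOL.refl] by metis
  qed
  then show ?thesis using that by blast
qed

lemma char_variety_curve:
  obtains P :: "int poly poly" where "lead_coeff P = 1" "coords G \<mu> \<beta> ` char_variety G = zero_locus {complexify P}"
proof -
  have pq: "odd p" "odd q" "coprime p q" "0 < q" "q < p"
    using pres by (auto simp: two_bridge_presentation_def)
  obtain m where m: "p = 2 * m + 1" using pq(1) by (elim oddE)
  obtain a b c d where abcd: "riley \<omega> = (a, b, c, d)" by (cases "riley \<omega>")
  have d: "d = 0" by (rule riley_symmetric[OF rev_two_bridge_word[OF pq] abcd])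
  have deg: "(\<forall>i>m. coeff c i = 0) \<and> coeff c m \<in> {1, -1}"
    using riley_degree[OF two_bridge_word_pairs[of m q] abcd[unfolded m]] by simp
  then have "degree c = m" by (intro antisym degree_le le_degree) auto
  \<comment> \<open>The first factor is \<open>y - x\<^sup>2 + 2\<close>; the scalar, 1 or -1, makes
    the second one monic.\<close>
  define P where "P = [:[:2, 0, -1:], 1:] * smult (coeff c m) c"
  have "lead_coeff P = 1"
    unfolding P_def lead_coeff_mult lead_coeff_smult using deg \<open>degree c = m\<close> by auto
  moreover have "coords G \<mu> \<beta> ` char_variety G = zero_locus {complexify P}"
  proof (rule Set.set_eqI)
    fix z :: "complex \<times> complex"
    obtain x y where z: "z = (x, y)" by (cases z)
    have "poly2 (complexify P) (x, y) = 0 \<longleftrightarrow> y = x\<^sup>2 - 2 \<or> poly2 (complexify c) (x, y) = 0"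
    proof -
      have "poly2 (complexify [:[:2, 0, -1:], 1:]) (x, y) = y - (x\<^sup>2 - 2)"
        by (simp add: map_poly_pCons power2_eq_square)
      moreover have "poly2 (complexify (smult (coeff c m) c)) (x, y) = 0 \<longleftrightarrow> poly2 (complexify c) (x, y) = 0"
        using deg by auto
      ultimately show ?thesis unfolding P_def complexify_mult poly2_mult mult_eq_0_iff by (simp only: right_minus_eq)
    qed
    then show "z \<in> coords G \<mu> \<beta> ` char_variety G \<longleftrightarrow> z \<in> zero_locus {complexify P}"
      unfolding z coords_char_variety using relation_curve[OF abcd[unfolded d], of x y] by (simp add: zero_locus_def)
  qed
  ultimately show ?thesis using that by blast
qed

end

section \<open>Free bases of coordinate and trace rings\<close>

text \<open>One closure condition that serves the complex numbers, the rationals, the integers and,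
  iterated, the polynomials over them.\<close>

definition subring_set :: "'a::comm_ring_1 set \<Rightarrow> bool" where
  "subring_set K \<longleftrightarrow> 1 \<in> K \<and> (\<forall>a\<in>K. \<forall>b\<in>K. a - b \<in> K \<and> a * b \<in> K)"

text \<open>This is \<open>K[x]\<close>; applied twice it gives \<open>K[x, y]\<close>.\<close>

definition poly_over :: "'a::comm_ring_1 set \<Rightarrow> 'a poly set" where
  "poly_over K = {p. \<forall>i. coeff p i \<in> K}"

lemma subring_setD:
  assumes "subring_set K"
  shows "0 \<in> K" "1 \<in> K" "a \<in> K \<Longrightarrow> - a \<in> K" "a \<in> K \<Longrightarrow> b \<in> K \<Longrightarrow> a + b \<in> K"
    "a \<in> K \<Longrightarrow> b \<in> K \<Longrightarrow> a - b \<in> K" "a \<in> K \<Longrightarrow> b \<in> K \<Longrightarrow> a * b \<in> K"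
proof -
  have diff: "a - b \<in> K" if "a \<in> K" "b \<in> K" for a b using assms that by (simp add: subring_set_def)
  show "1 \<in> K" using assms by (simp add: subring_set_def)
  from diff[OF this this] show 0: "0 \<in> K" by simp
  show neg: "- a \<in> K" if "a \<in> K" for a using diff[OF 0 that] by simp
  show "a \<in> K \<Longrightarrow> b \<in> K \<Longrightarrow> a + b \<in> K" using diff[OF _ neg, of a b] by simp
  show "a \<in> K \<Longrightarrow> b \<in> K \<Longrightarrow> a - b \<in> K" by (rule diff)
  show "a \<in> K \<Longrightarrow> b \<in> K \<Longrightarrow> a * b \<in> K" using assms by (simp add: subring_set_def)
qed

lemma subring_set_sum:
  assumes "subring_set K" "\<And>i. i \<in> I \<Longrightarrow> f i \<in> K"
  shows "sum f I \<in> K"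
  using assms(2) by (induction I rule: infinite_finite_induct) (simp_all add: subring_setD[OF assms(1)])

lemma subring_set_poly_over: "subring_set K \<Longrightarrow> subring_set (poly_over K)"
  unfolding subring_set_def[of "poly_over K"]
  by (auto simp: poly_over_def coeff_mult subring_setD intro!: subring_set_sum)

lemma subring_set_UNIV: "subring_set UNIV" and subring_set_Rats: "subring_set (\<rat> :: complex set)"
  and subring_set_Ints: "subring_set (\<int> :: complex set)"
  by (auto simp: subring_set_def)

lemma poly_over_pCons_iff: "subring_set K \<Longrightarrow> pCons a p \<in> poly_over K \<longleftrightarrow> a \<in> K \<and> p \<in> poly_over K"
  unfolding poly_over_def by (auto simp: coeff_pCons split: nat.splits)

lemma poly_over_0: "subring_set K \<Longrightarrow> 0 \<in> poly_over K"
  by (simp add: poly_over_def subring_setD)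

text \<open>Long division by a monic polynomial never divides coefficients, so the remainder stays
  over \<open>K\<close>.\<close>

lemma monic_division:
  fixes F P :: "'a::comm_ring_1 poly"
  assumes K: "subring_set K" and F: "F \<in> poly_over K" "lead_coeff F = 1" "degree F > 0" and P: "P \<in> poly_over K"
  obtains q r where "P = F * q + r" "r \<in> poly_over K" "degree r < degree F"
proof -
  have "\<exists>q r. P = F * q + r \<and> r \<in> poly_over K \<and> degree r < degree F"
    using P
  proof (induction "degree P" arbitrary: P rule: less_induct)
    case less
    note K' = subring_setD[OF subring_set_poly_over[OF K]]
    show ?case
    proof (cases "degree P < degree F")
      case True
      then show ?thesis using less.prems by (intro exI[of _ 0] exI[of _ P]) simp
    next
      case False
      define M where "M = monom (lead_coeff P) (degree P - degree F)"
      have "M \<in> poly_over K" using less.prems by (simp add: M_def poly_over_def subring_setD(1)[OF K])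
      then have R: "P - F * M \<in> poly_over K" using less.prems F(1) by (intro K')
      have "coeff (P - F * M) i = 0" if "i \<ge> degree P" for i
      proof (cases "i = degree P")
        case True
        then show ?thesis using False F(2)
          by (simp add: M_def mult.commute[of F] coeff_monom_mult)
      next
        case False
        then have "i > degree P" using that by simp
        then show ?thesis using \<open>\<not> degree P < degree F\<close>
          by (simp add: M_def mult.commute[of F] coeff_monom_mult coeff_eq_0)
      qed
      \<comment> \<open>The zero polynomial has degree 0, so cancelling the leading term lowers the
        degree strictly only for nonconstant \<open>P\<close>; this is where
        \<open>degree F > 0\<close> is used.\<close>
      moreover have "degree P > 0" using False F(3) by simp
      ultimately have "degree (P - F * M) < degree P"
        by (metis leading_coeff_0_iff degree_0 not_le_imp_less)
      from less.hyps[OF this R] obtain q r where "P - F * M = F * q + r" "r \<in> poly_over K" "degree r < degree F" by blast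
      then show ?thesis by (intro exI[of _ "M + q"] exI[of _ r]) (simp add: algebra_simps)
    qed
  qed
  then show ?thesis using that by blast
qed

lemma sum_monom_coeff: "degree r < n \<Longrightarrow> r = (\<Sum>i<n. monom (coeff r i) i)"
  by (intro poly_eqI) (auto simp: coeff_sum coeff_eq_0)

section \<open>Polynomial functions on a set of characters\<close>

context
  fixes G :: "('g, 'm) monoid_scheme" and \<mu> \<beta> :: 'g and X :: "('g \<Rightarrow> complex) set"
begin

text \<open>The surjective restriction homomorphism from polynomials in the plane to the coordinate
  ring; computations in that ring are pulled back along it.\<close>

definition poly_function :: "complex poly poly \<Rightarrow> ('g \<Rightarrow> complex) \<Rightarrow> complex" where
  "poly_function P = (\<lambda>\<xi>\<in>X. poly2 P (coords G \<mu> \<beta> \<xi>))"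

abbreviation (input) CR :: "(('g \<Rightarrow> complex) \<Rightarrow> complex) ring" where
  "CR \<equiv> coord_ring G \<mu> \<beta> X"

lemma coord_ring_simps:
  "carrier CR = range poly_function" "poly_function P \<otimes>\<^bsub>CR\<^esub> poly_function Q = poly_function (P * Q)" "poly_function P \<oplus>\<^bsub>CR\<^esub> poly_function Q = poly_function (P + Q)"
  "\<one>\<^bsub>CR\<^esub> = poly_function 1" "\<zero>\<^bsub>CR\<^esub> = poly_function 0"
  by (auto simp: coord_ring_def poly_function_def)

lemma poly_function_eq_iff: "poly_function P = poly_function Q \<longleftrightarrow> (\<forall>z\<in>coords G \<mu> \<beta> ` X. poly2 (P - Q) z = 0)"
  by (auto simp: poly_function_def fun_eq_iff restrict_def)

lemma cring_coord_ring: "cring CR"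
proof (rule cringI)
  show "abelian_group CR"
  proof (rule abelian_groupI)
    show "\<exists>y\<in>carrier CR. y \<oplus>\<^bsub>CR\<^esub> x = \<zero>\<^bsub>CR\<^esub>" if x: "x \<in> carrier CR" for x
    proof -
      obtain P where "x = poly_function P" using x by (auto simp: coord_ring_simps)
      then show ?thesis by (intro bexI[of _ "poly_function (- P)"]) (simp_all add: coord_ring_simps)
    qed
  qed (auto simp: coord_ring_simps algebra_simps)
  show "Group.comm_monoid CR"
    by (rule comm_monoidI) (auto simp: coord_ring_simps algebra_simps)
qed (auto simp: coord_ring_simps algebra_simps)

lemma poly_function_uminus: "\<ominus>\<^bsub>CR\<^esub> poly_function P = poly_function (- P)"
proof -
  interpret cring CR by (rule cring_coord_ring)
  show ?thesis by (rule minus_equality) (simp_all add: coord_ring_simps)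
qed

lemma poly_function_constants: "const_fun X c = poly_function [:[:c:]:]" "I_fun X \<mu> = poly_function [:[:0, 1:]:]"
  "I_fun X (\<mu> \<otimes>\<^bsub>G\<^esub> \<beta>) = poly_function [:0, 1:]"
  by (auto simp: const_fun_def I_fun_def poly_function_def coords_def)

lemma poly_function_power: "poly_function P [^]\<^bsub>CR\<^esub> (j :: nat) = poly_function (P ^ j)"
proof -
  interpret cring CR by (rule cring_coord_ring)
  show ?thesis by (induction j) (simp_all add: coord_ring_simps mult.commute)
qed

lemma subring_poly_function:
  assumes "subring_set K"
  shows "subring (poly_function ` K) CR"
proof -
  interpret cring CR by (rule cring_coord_ring)
  note K = subring_setD[OF assms]
  show ?thesis
    by (rule subringI) (auto simp: coord_ring_simps poly_function_uminus K intro!: imageI)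
qed

text \<open>Horner's scheme, starting from the constants and the function of
  \<open>\<mu>\<close>.\<close>

lemma poly_function_const_poly_in:
  assumes S: "subring S CR" and K: "subring_set K" "const_fun X ` K \<subseteq> S" and "I_fun X \<mu> \<in> S" and p: "p \<in> poly_over K"
  shows "poly_function [:p:] \<in> S"
proof -
  interpret cring CR by (rule cring_coord_ring)
  note S' = subringE[OF S]
  show ?thesis
    using p
  proof (induction p)
    case 0
    show ?case using S'(2) by (simp add: coord_ring_simps)
  next
    case (pCons a p)
    have "poly_function [:pCons a p:] = const_fun X a \<oplus>\<^bsub>CR\<^esub> I_fun X \<mu> \<otimes>\<^bsub>CR\<^esub> poly_function [:p:]"
      unfolding poly_function_constants coord_ring_simps by simp
    moreover have "a \<in> K" "p \<in> poly_over K" using pCons.prems K(1) by (simp_all add: poly_over_pCons_iff)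
    ultimately show ?case using pCons.IH K(2) assms(4) S'(6,7) by auto
  qed
qed

lemma poly_function_poly_in:
  assumes S: "subring S CR" and K: "subring_set K" "const_fun X ` K \<subseteq> S" and I: "I_fun X \<mu> \<in> S" "I_fun X (\<mu> \<otimes>\<^bsub>G\<^esub> \<beta>) \<in> S"
  shows "poly_function ` poly_over (poly_over K) \<subseteq> S"
proof
  fix h assume "h \<in> poly_function ` poly_over (poly_over K)"
  then obtain P where h: "h = poly_function P" and P: "P \<in> poly_over (poly_over K)" by blast
  interpret cring CR by (rule cring_coord_ring)
  note S' = subringE[OF S]
  have "poly_function P \<in> S"
    using P
  proof (induction P)
    case 0
    show ?case using S'(2) by (simp add: coord_ring_simps)
  next
    case (pCons p P)
    have "poly_function (pCons p P) = poly_function [:p:] \<oplus>\<^bsub>CR\<^esub> I_fun X (\<mu> \<otimes>\<^bsub>G\<^esub> \<beta>) \<otimes>\<^bsub>CR\<^esub> poly_function P"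
      unfolding poly_function_constants coord_ring_simps by simp
    moreover have "p \<in> poly_over K" "P \<in> poly_over (poly_over K)"
      using pCons.prems subring_set_poly_over[OF K(1)] by (simp_all add: poly_over_pCons_iff)
    ultimately show ?case using pCons.IH poly_function_const_poly_in[OF S K I(1)] I(2) S'(6,7) by auto
  qed
  then show "h \<in> S" by (simp add: h)
qed

definition const_polys :: "complex set \<Rightarrow> complex poly poly set" where
  "const_polys K = (\<lambda>p. [:p:]) ` poly_over K"

lemma subring_set_const_polys: "subring_set K \<Longrightarrow> subring_set (const_polys K)"
proof -
  assume "subring_set K"
  note K = subring_setD[OF subring_set_poly_over[OF this]]
  show ?thesis
    unfolding const_polys_def subring_set_def[of "_ ` _"]
    using K(2,5,6) by (auto simp: one_pCons[where ?'a = "complex poly"])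
qed

lemma I_mu_ring_eq:
  assumes K: "subring_set K"
  shows "I_mu_ring G \<mu> \<beta> X K = poly_function ` const_polys K"
proof
  interpret cring CR by (rule cring_coord_ring)
  have H: "const_fun X ` K \<union> {I_fun X \<mu>} \<subseteq> carrier CR"
    by (auto simp: poly_function_constants coord_ring_simps)
  have *: "[:[:c:]:] \<in> const_polys K" if "c \<in> K" for c
    unfolding const_polys_def using that K by (intro imageI) (simp add: poly_over_pCons_iff poly_over_0)
  have "[:[:0, 1:]:] \<in> const_polys K"
    unfolding const_polys_def using K by (intro imageI) (simp add: poly_over_pCons_iff poly_over_0 subring_setD)
  then show "I_mu_ring G \<mu> \<beta> X K \<subseteq> poly_function ` const_polys K"
    unfolding I_mu_ring_def using *
    by (intro generate_ring_min_subring1[OF H] subring_poly_function subring_set_const_polys K)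
      (auto simp: poly_function_constants)
  show "poly_function ` const_polys K \<subseteq> I_mu_ring G \<mu> \<beta> X K"
  proof -
    have "const_fun X ` K \<subseteq> I_mu_ring G \<mu> \<beta> X K" "I_fun X \<mu> \<in> I_mu_ring G \<mu> \<beta> X K"
      by (auto simp: I_mu_ring_def intro: generate_ring.incl)
    moreover have "subring (I_mu_ring G \<mu> \<beta> X K) CR"
      unfolding I_mu_ring_def by (rule generate_ring_is_subring[OF H])
    ultimately show ?thesis
      using poly_function_const_poly_in[OF _ K] by (auto simp: const_polys_def)
  qed
qed

lemma abelian_group_mult_module:
  assumes "subring M CR"
  shows "abelian_group (mult_module CR M)"
proof -
  interpret cring CR by (rule cring_coord_ring)
  note M = subringE[OF assms]
  have car: "x \<in> M \<Longrightarrow> x \<in> carrier CR" for x using M(1) by blast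
  have s: "carrier (mult_module CR M) = M" "\<zero>\<^bsub>mult_module CR M\<^esub> = \<zero>\<^bsub>CR\<^esub>"
    "x \<oplus>\<^bsub>mult_module CR M\<^esub> y = x \<oplus>\<^bsub>CR\<^esub> y" for x y
    by (simp_all add: mult_module_def)
  show ?thesis
  proof (rule abelian_groupI, unfold s)
    fix x y z assume xyz: "x \<in> M" "y \<in> M" "z \<in> M"
    show "x \<oplus>\<^bsub>CR\<^esub> y \<oplus>\<^bsub>CR\<^esub> z = x \<oplus>\<^bsub>CR\<^esub> (y \<oplus>\<^bsub>CR\<^esub> z)" by (rule a_assoc) (use car xyz in auto)
  next
    fix x y assume xy: "x \<in> M" "y \<in> M"
    show "x \<oplus>\<^bsub>CR\<^esub> y \<in> M" using xy by (rule M(7))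
    show "x \<oplus>\<^bsub>CR\<^esub> y = y \<oplus>\<^bsub>CR\<^esub> x" by (rule a_comm) (use car xy in auto)
  next
    fix x assume x: "x \<in> M"
    show "\<zero>\<^bsub>CR\<^esub> \<oplus>\<^bsub>CR\<^esub> x = x" using car[OF x] by (rule l_zero)
    show "\<exists>y\<in>M. y \<oplus>\<^bsub>CR\<^esub> x = \<zero>\<^bsub>CR\<^esub>" using M(5)[OF x] l_neg[OF car[OF x]] by blast
  qed (rule M(2))
qed

lemma module_mult_module:
  assumes "subring R CR" "subring M CR" "R \<subseteq> M"
  shows "Module.module (CR\<lparr>carrier := R\<rparr>) (mult_module CR M)"
proof -
  interpret cring CR by (rule cring_coord_ring)
  note R = subringE[OF assms(1)] and M = subringE[OF assms(2)]
  show ?thesis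
  proof (rule moduleI)
    show "cring (CR\<lparr>carrier := R\<rparr>)"
      using subcringI'[OF assms(1)] subcring_iff[OF R(1)] by simp
    show "abelian_group (mult_module CR M)" by (rule abelian_group_mult_module[OF assms(2)])
  qed (use assms(3) R M in \<open>auto simp: mult_module_def l_distr r_distr m_assoc subset_iff\<close>)
qed

lemma finsum_mult_module:
  assumes "subring_set K" "finite I" "\<And>i. i \<in> I \<Longrightarrow> g i \<in> K"
  shows "(\<Oplus>\<^bsub>mult_module CR (poly_function ` K)\<^esub>i\<in>I. poly_function (g i)) = poly_function (\<Sum>i\<in>I. g i)"
proof -
  interpret M: abelian_group "mult_module CR (poly_function ` K)"
    by (intro abelian_group_mult_module subring_poly_function assms)
  have M: "carrier (mult_module CR (poly_function ` K)) = poly_function ` K" "\<zero>\<^bsub>mult_module CR (poly_function ` K)\<^esub> = poly_function 0"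
    "poly_function P \<oplus>\<^bsub>mult_module CR (poly_function ` K)\<^esub> poly_function Q = poly_function (P + Q)" for P Q
    by (simp_all add: mult_module_def coord_ring_simps)
  show ?thesis
    using assms(2,3) by (induction I) (auto simp: M M.finsum_insert)
qed

text \<open>Existence of coefficients is division with remainder by \<open>F\<close>. For
  uniqueness, the difference of two expansions has degree below \<open>degree F\<close> and vanishes
  on the curve, so the prime \<open>F\<close> divides it and it is 0.\<close>

lemma free_basis_powers:
  assumes K: "subring_set K" and F: "F \<in> poly_over (poly_over K)" "lead_coeff F = 1" "degree F > 0"
    and prime: "prime_elem F" and V: "coords G \<mu> \<beta> ` X = zero_locus {F}"
  shows "free_basis_in CR (I_mu_ring G \<mu> \<beta> X K) (poly_function ` poly_over (poly_over K)) {..<degree F}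
    (\<lambda>j. I_fun X (\<mu> \<otimes>\<^bsub>G\<^esub> \<beta>) [^]\<^bsub>CR\<^esub> j)"
proof -
  let ?M = "mult_module CR (poly_function ` poly_over (poly_over K))"
  let ?b = "\<lambda>j. I_fun X (\<mu> \<otimes>\<^bsub>G\<^esub> \<beta>) [^]\<^bsub>CR\<^esub> (j :: nat)"
  let ?n = "degree F"
  note K' = subring_set_poly_over[OF K]
  note K'' = subring_set_poly_over[OF K']
  have b: "?b j = poly_function (monom 1 j)" for j
    by (simp add: poly_function_constants poly_function_power monom_altdef)
  have mon: "monom p j \<in> poly_over (poly_over K)" if "p \<in> poly_over K" for p j
    using that subring_setD(1)[OF K'] by (auto simp: poly_over_def[of "poly_over K"])
  have sum: "(\<Oplus>\<^bsub>?M\<^esub>i\<in>{..<?n}. c i \<odot>\<^bsub>?M\<^esub> ?b i) = poly_function (\<Sum>i<?n. monom (p i) i)"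
    if c: "\<And>i. i < ?n \<Longrightarrow> c i = poly_function [:p i:] \<and> p i \<in> poly_over K" for c p
  proof -
    have "c i \<odot>\<^bsub>?M\<^esub> ?b i = poly_function (monom (p i) i)" if "i < ?n" for i
      using c[OF that] unfolding b by (simp add: mult_module_def coord_ring_simps smult_monom)
    then have "(\<Oplus>\<^bsub>?M\<^esub>i\<in>{..<?n}. c i \<odot>\<^bsub>?M\<^esub> ?b i) = (\<Oplus>\<^bsub>?M\<^esub>i\<in>{..<?n}. poly_function (monom (p i) i))"
      using c mon
      by (intro abelian_monoid.finsum_cong'[OF abelian_group.axioms(1)[OF abelian_group_mult_module[OF subring_poly_function[OF K'']]]])
        (auto simp: mult_module_def)
    also have "\<dots> = poly_function (\<Sum>i<?n. monom (p i) i)"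
      using c mon by (intro finsum_mult_module[OF K'']) auto
    finally show ?thesis .
  qed
  have ex1: "\<exists>!c. c \<in> {..<?n} \<rightarrow>\<^sub>E poly_function ` const_polys K \<and> m = (\<Oplus>\<^bsub>?M\<^esub>i\<in>{..<?n}. c i \<odot>\<^bsub>?M\<^esub> ?b i)"
    if m: "m \<in> poly_function ` poly_over (poly_over K)" for m
  proof (rule ex_ex1I)
    obtain P where P: "P \<in> poly_over (poly_over K)" "m = poly_function P" using m by blast
    obtain q r where r: "P = F * q + r" "r \<in> poly_over (poly_over K)" "degree r < ?n"
      by (rule monic_division[OF K' F P(1)])
    have "m = poly_function r"
      unfolding P(2) poly_function_eq_iff V r(1) by (simp add: zero_locus_def)
    also have "r = (\<Sum>i<?n. monom (coeff r i) i)" using r(3) by (rule sum_monom_coeff)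
    finally have m: "m = poly_function (\<Sum>i<?n. monom (coeff r i) i)" .
    have rc: "coeff r i \<in> poly_over K" for i using r(2) by (simp add: poly_over_def[of "poly_over K"])
    have "(\<lambda>i\<in>{..<?n}. poly_function [:coeff r i:]) \<in> {..<?n} \<rightarrow>\<^sub>E poly_function ` const_polys K"
      using rc by (auto simp: const_polys_def)
    moreover have "m = (\<Oplus>\<^bsub>?M\<^esub>i\<in>{..<?n}. (\<lambda>i\<in>{..<?n}. poly_function [:coeff r i:]) i \<odot>\<^bsub>?M\<^esub> ?b i)"
      unfolding m by (rule sum[symmetric]) (simp add: rc)
    ultimately show "\<exists>c. c \<in> {..<?n} \<rightarrow>\<^sub>E poly_function ` const_polys K \<and> m = (\<Oplus>\<^bsub>?M\<^esub>i\<in>{..<?n}. c i \<odot>\<^bsub>?M\<^esub> ?b i)" by blast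
  next
    fix c c'
    assume c: "c \<in> {..<?n} \<rightarrow>\<^sub>E poly_function ` const_polys K \<and> m = (\<Oplus>\<^bsub>?M\<^esub>i\<in>{..<?n}. c i \<odot>\<^bsub>?M\<^esub> ?b i)"
      and c': "c' \<in> {..<?n} \<rightarrow>\<^sub>E poly_function ` const_polys K \<and> m = (\<Oplus>\<^bsub>?M\<^esub>i\<in>{..<?n}. c' i \<odot>\<^bsub>?M\<^esub> ?b i)"
    \<comment> \<open>Coefficients are functions on \<open>X\<close>; polynomials in
      \<open>x\<close> are chosen that represent them.\<close>
    have ex: "\<exists>p. \<forall>i<?n. e i = poly_function [:p i:] \<and> p i \<in> poly_over K" if "e \<in> {..<?n} \<rightarrow>\<^sub>E poly_function ` const_polys K" for e
    proof -
      have "\<forall>i. \<exists>p. i < ?n \<longrightarrow> e i = poly_function [:p:] \<and> p \<in> poly_over K"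
        using that by (fastforce simp: const_polys_def PiE_iff)
      then show ?thesis by metis
    qed
    obtain p where p: "\<forall>i<?n. c i = poly_function [:p i:] \<and> p i \<in> poly_over K" using ex[of c] c by blast
    obtain p' where p': "\<forall>i<?n. c' i = poly_function [:p' i:] \<and> p' i \<in> poly_over K" using ex[of c'] c' by blast
    define D where "D = (\<Sum>i<?n. monom (p i) i) - (\<Sum>i<?n. monom (p' i) i)"
    have cD: "coeff D i = (if i < ?n then p i - p' i else 0)" for i
      by (simp add: D_def coeff_sum)
    have "poly_function (\<Sum>i<?n. monom (p i) i) = poly_function (\<Sum>i<?n. monom (p' i) i)"
      using c c' sum[OF p[rule_format]] sum[OF p'[rule_format]] by simp
    then have "zero_locus {F} \<subseteq> zero_locus {D}"
      unfolding poly_function_eq_iff V D_def by (auto simp: zero_locus_def)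
    then have "F dvd D" by (rule prime_dvd_if_vanishes[OF prime F(2,3)])
    have "D = 0"
    proof (rule ccontr)
      assume "D \<noteq> 0"
      with \<open>F dvd D\<close> have "?n \<le> degree D" by (rule dvd_imp_degree_le)
      then have "lead_coeff D = 0" unfolding cD by simp
      then show False using \<open>D \<noteq> 0\<close> by simp
    qed
    then have "p i = p' i" if "i < ?n" for i using cD[of i] that by simp
    then show "c = c'" using p p' c c' by (intro PiE_ext[of c "{..<?n}" "\<lambda>_. poly_function ` const_polys K"]) auto
  qed
  have sub: "const_polys K \<subseteq> poly_over (poly_over K)"
    by (auto simp: const_polys_def poly_over_pCons_iff[OF K'] poly_over_0[OF K'])
  have "?b j \<in> poly_function ` poly_over (poly_over K)" for j
    unfolding b using mon[of 1] subring_setD(2)[OF K'] by (intro imageI)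
  moreover have "Module.module (CR\<lparr>carrier := poly_function ` const_polys K\<rparr>) ?M"
    using sub by (intro module_mult_module subring_poly_function subring_set_const_polys K K'') auto
  ultimately show ?thesis
    unfolding free_basis_in_def free_basis_def I_mu_ring_eq[OF K]
    using ex1 by (auto simp: mult_module_def)
qed

end

section \<open>The three rings as images of polynomial rings, and their bases\<close>

theorem corollary1p5:
  fixes G :: "('g, 'm) monoid_scheme"
    and \<mu> \<beta> :: 'g
    and p q :: nat
    and X :: "('g \<Rightarrow> complex) set"
  assumes "two_bridge_presentation G \<mu> \<beta> p q"
    and "X \<subseteq> char_variety G"
    and "irreducible_component (coords G \<mu> \<beta> ` X) (coords G \<mu> \<beta> ` char_variety G)"
    and "defined_over_Q (coords G \<mu> \<beta> ` X)"
  shows "\<exists>(n :: nat) (c :: nat \<Rightarrow> int poly).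
    n \<ge> 1 \<and>
    (\<exists>F :: complex poly poly.
       F = Polynomial.monom 1 n - (\<Sum>j<n. Polynomial.monom (map_poly of_int (c j)) j) \<and>
       Factorial_Ring.irreducible F \<and>
       coords G \<mu> \<beta> ` X = zero_locus {F}) \<and>
    (let CX = coord_ring G \<mu> \<beta> X;
         b = (\<lambda>j. I_fun X (\<mu> \<otimes>\<^bsub>G\<^esub> \<beta>) [^]\<^bsub>CX\<^esub> j)
     in free_basis_in CX (I_mu_ring G \<mu> \<beta> X UNIV) (carrier CX) {..<n} b \<and>
        free_basis_in CX (I_mu_ring G \<mu> \<beta> X \<rat>) (trace_algebra_Q G \<mu> \<beta> X) {..<n} b \<and>
        free_basis_in CX (I_mu_ring G \<mu> \<beta> X \<int>) (trace_ring G \<mu> \<beta> X) {..<n} b)"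
proof -
  obtain P :: "int poly poly" where P: "lead_coeff P = 1" "coords G \<mu> \<beta> ` char_variety G = zero_locus {complexify P}"
    by (rule char_variety_curve[OF assms(1)])
  obtain f :: "int poly poly" where f: "lead_coeff f = 1" "degree f > 0" "prime_elem (complexify f)"
    and V: "coords G \<mu> \<beta> ` X = zero_locus {complexify f}"
    using component_defined_over_Q[OF P(1) assms(3)[unfolded P(2)] assms(4)] .
  let ?E = "poly_function G \<mu> \<beta> X" and ?CX = "coord_ring G \<mu> \<beta> X"
  let ?PP = "\<lambda>K. poly_over (poly_over K)"
  interpret CX: cring ?CX by (rule cring_coord_ring)
  have complexify: "complexify Q \<in> ?PP K" if "\<int> \<subseteq> K" for Q K
    using that by (auto simp: poly_over_def coeff_complexify coeff_map_poly)
  note gens = generators_closed[OF assms(1)] monoid.m_closed[OF group.is_monoid[OF group_G[OF assms(1)]] generators_closed[OF assms(1)]]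

  have carrier: "carrier ?CX = ?E ` ?PP UNIV"
    by (simp add: coord_ring_simps poly_over_def)
  have I: "I_fun X g \<in> ?E ` ?PP \<int>" if g: "g \<in> carrier G" for g
  proof -
    obtain Q where "\<forall>\<xi>\<in>char_variety G. \<xi> g = poly2 (complexify Q) (coords G \<mu> \<beta> \<xi>)"
      by (rule character_polynomial[OF assms(1) g])
    then have "I_fun X g = ?E (complexify Q)"
      using assms(2) unfolding I_fun_def poly_function_def by (intro restrict_ext) blast
    then show ?thesis using complexify[of \<int>] by blast
  qed
  have I_carrier: "I_fun X ` carrier G \<subseteq> carrier ?CX"
    using I unfolding coord_ring_simps by blast
  have T_subring: "subring (trace_ring G \<mu> \<beta> X) ?CX"
    unfolding trace_ring_def by (rule CX.generate_ring_is_subring[OF I_carrier])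
  have I_T: "I_fun X g \<in> trace_ring G \<mu> \<beta> X" if "g \<in> carrier G" for g
    unfolding trace_ring_def using that by (intro generate_ring.incl imageI)
  have subring_PP: "subring (?E ` ?PP K) ?CX" if "subring_set K" for K
    by (intro subring_poly_function subring_set_poly_over that)
  \<comment> \<open>The trace ring is generated by traces alone; its integral constants come from
    the unit element.\<close>
  have const_Z: "const_fun X ` \<int> \<subseteq> S" if S: "subring S ?CX" for S
  proof -
    note S' = subringE[OF S]
    have nat: "?E [:[:of_nat k:]:] \<in> S" for k
    proof (induction k)
      case 0
      show ?case using S'(2) by (simp add: coord_ring_simps)
    next
      case (Suc k)
      have "?E [:[:of_nat (Suc k):]:] = ?E 1 \<oplus>\<^bsub>?CX\<^esub> ?E [:[:of_nat k:]:]"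
        unfolding coord_ring_simps by (simp add: one_pCons)
      then show ?case using S'(7)[OF S'(3) Suc] by (simp only: coord_ring_simps(4))
    qed
    have "?E [:[:of_int k:]:] \<in> S" for k
    proof (cases k rule: int_cases2)
      case (nonneg n)
      then show ?thesis using nat[of n] by simp
    next
      case (nonpos n)
      then show ?thesis using S'(5)[OF nat[of n]] by (simp add: poly_function_uminus)
    qed
    then show ?thesis by (auto simp: poly_function_constants[where X = X and G = G and \<mu> = \<mu> and \<beta> = \<beta>] elim!: Ints_cases)
  qed
  \<comment> \<open>All traces are integral polynomials in the two coordinates, and the coordinates
    are themselves traces.\<close>
  have T: "trace_ring G \<mu> \<beta> X = ?E ` ?PP \<int>"
  proof
    show "trace_ring G \<mu> \<beta> X \<subseteq> ?E ` ?PP \<int>"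
      unfolding trace_ring_def using I
      by (intro CX.generate_ring_min_subring1[OF I_carrier subring_PP] subring_set_Ints) auto
    show "?E ` ?PP \<int> \<subseteq> trace_ring G \<mu> \<beta> X"
      by (intro poly_function_poly_in T_subring subring_set_Ints const_Z I_T gens)
  qed
  have TQ: "trace_algebra_Q G \<mu> \<beta> X = ?E ` ?PP \<rat>"
  proof
    have "?PP \<int> \<subseteq> ?PP \<rat>" using Ints_subset_Rats by (auto simp: poly_over_def)
    moreover have "const_fun X ` \<rat> \<subseteq> ?E ` ?PP \<rat>"
      by (auto simp: poly_function_constants[where X = X and G = G and \<mu> = \<mu> and \<beta> = \<beta>] poly_over_pCons_iff subring_set_poly_over subring_set_Rats poly_over_0 intro!: imageI)
    ultimately show "trace_algebra_Q G \<mu> \<beta> X \<subseteq> ?E ` ?PP \<rat>"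
      unfolding trace_algebra_Q_def T by (intro Inter_lower) (auto intro!: subring_PP subring_set_Rats)
    show "?E ` ?PP \<rat> \<subseteq> trace_algebra_Q G \<mu> \<beta> X"
      unfolding trace_algebra_Q_def
    proof (intro Inter_greatest)
      fix S assume "S \<in> {S. subring S ?CX \<and> const_fun X ` \<rat> \<subseteq> S \<and> trace_ring G \<mu> \<beta> X \<subseteq> S}"
      then show "?E ` ?PP \<rat> \<subseteq> S"
        using I_T gens by (intro poly_function_poly_in subring_set_Rats) auto
    qed
  qed

  define n where "n = degree f"
  \<comment> \<open>The sign is changed because the required form subtracts the lower terms.\<close>
  define c where "c j = - coeff f j" for j
  have eq: "complexify f = Polynomial.monom 1 n - (\<Sum>j<n. Polynomial.monom (map_poly of_int (c j)) j)"
  proof (rule poly_eqI)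
    fix i
    have "map_poly of_int (- r) = - (map_poly of_int r :: complex poly)" for r
      by (rule poly_eqI) (simp add: coeff_map_poly)
    then show "coeff (complexify f) i = coeff (Polynomial.monom 1 n - (\<Sum>j<n. Polynomial.monom (map_poly of_int (c j)) j)) i"
      using f(1) by (cases i n rule: linorder_cases) (auto simp: coeff_complexify coeff_sum c_def n_def coeff_eq_0)
  qed
  have irr: "Factorial_Ring.irreducible (complexify f)" using f(3) by (rule prime_elem_imp_irreducible)
  \<comment> \<open>As \<open>f\<close> is integral, one statement covers complex, rational and
    integral scalars.\<close>
  have basis: "free_basis_in ?CX (I_mu_ring G \<mu> \<beta> X K) (?E ` ?PP K) {..<n} (\<lambda>j. I_fun X (\<mu> \<otimes>\<^bsub>G\<^esub> \<beta>) [^]\<^bsub>?CX\<^esub> j)"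
    if "subring_set K" "\<int> \<subseteq> K" for K
    using free_basis_powers[OF that(1) complexify[OF that(2), of f] _ _ f(3) V] f(1,2) by (simp add: n_def coeff_complexify)
  show ?thesis
    unfolding Let_def carrier T TQ
  proof (rule exI[of _ n], rule exI[of _ c], intro conjI)
    show "n \<ge> 1" using f(2) by (simp add: n_def)
    show "\<exists>F. F = Polynomial.monom 1 n - (\<Sum>j<n. Polynomial.monom (map_poly of_int (c j)) j) \<and>
        Factorial_Ring.irreducible F \<and> coords G \<mu> \<beta> ` X = zero_locus {F}"
      using eq irr V by blast
  qed (intro basis subring_set_UNIV subring_set_Rats subring_set_Ints Ints_subset_Rats subset_UNIV order_refl)+
qed

end
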